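(* Let $\Bbbk$ be a commutative ring, $G$ a group and $H\leq G$ an arbitrary subgroup. Write $\mathscr C(G)=\Bbbk G\text{-}\mathrm{Mod}$ and $\mathscr C(H)=\Bbbk H\text{-}\mathrm{Mod}$ for the categories of left modules. Let $\mathbf A=\mathbf A^G_H=\mathrm{CoInd}_H^G\circ\mathrm{Res}^G_H$ be the monad on $\mathscr C(G)$ induced by the restriction-coinduction adjunction $\mathrm{Res}^G_H:\mathscr C(G)\leftrightarrows\mathscr C(H):\mathrm{CoInd}_H^G$. Then the Eilenberg-Moore functor $E:\mathscr C(H)\to\mathbf A\text{-}\mathrm{Mod}_{\mathscr C(G)}$, which satisfies $E\circ\mathrm{Res}^G_H=F_{\mathbf A}$ and $U_{\mathbf A}\circ E=\mathrm{CoInd}_H^G$, is an equivalence of categories. In words, $\mathscr C(H)$ is equivalent to the category of $\mathbf A$-modules in $\mathscr C(G)$ in such a way that restriction coincides with extension-of-scalars with respect to $\mathbf A$ and coinduction coincides with the functor which forgets $\mathbf A$-actions.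
   Context: $\mathrm{CoInd}_H^G(W)=\mathrm{Hom}_{\Bbbk H}(\Bbbk G,W)$ with left $G$-action via right multiplication on $\Bbbk G$; the unit $\eta$ and counit $\epsilon$ are $(\eta_V(v))(x)=x\cdot v$ and $\epsilon_W(f)=f(1)$. An adjunction $L:\mathscr C\leftrightarrows\mathscr D:R$ with unit $\eta$ and counit $\epsilon$ induces a monad $\mathbf A=RL$ on $\mathscr C$ with unit $\eta$ and multiplication $\mu=R\epsilon L$. An $\mathbf A$-module in $\mathscr C$ is a pair $(X,\varrho:\mathbf A(X)\to X)$ with $\varrho\circ\mathbf A(\varrho)=\varrho\circ\mu_X$ and $\varrho\circ\eta_X=\mathrm{id}_X$; morphisms are morphisms in $\mathscr C$ commuting with the actions. $F_{\mathbf A}(Y)=(\mathbf A(Y),\mu_Y)$ is extension-of-scalars, $U_{\mathbf A}(X,\varrho)=X$ is its right adjoint, and the Eilenberg-Moore functor is $E(Z)=(R(Z),R(\epsilon_Z))$, $E(f)=R(f)$. *)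

theory Defs
  imports "HOL-Algebra.Module"
begin

section \<open>Categories, functors, natural transformations\<close>

record ('o, 'a) cat =
  Obj :: "'o set"
  Arr :: "'a set"
  Dom :: "'a \<Rightarrow> 'o"
  Cod :: "'a \<Rightarrow> 'o"
  Ident :: "'o \<Rightarrow> 'a"
  Comp :: "'a \<Rightarrow> 'a \<Rightarrow> 'a"  \<comment> \<open>\<open>Comp C g f\<close> is \<open>g\<close> after \<open>f\<close>\<close>

definition Hom :: "('o, 'a) cat \<Rightarrow> 'o \<Rightarrow> 'o \<Rightarrow> 'a set" where
  "Hom C X Y = {f \<in> Arr C. Dom C f = X \<and> Cod C f = Y}"

definition is_category :: "('o, 'a) cat \<Rightarrow> bool" where
  "is_category C \<longleftrightarrow>
     (\<forall>f\<in>Arr C. Dom C f \<in> Obj C \<and> Cod C f \<in> Obj C) \<and>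
     (\<forall>X\<in>Obj C. Ident C X \<in> Hom C X X) \<and>
     (\<forall>f\<in>Arr C. \<forall>g\<in>Arr C. Cod C f = Dom C g \<longrightarrow> Comp C g f \<in> Hom C (Dom C f) (Cod C g)) \<and>
     (\<forall>f\<in>Arr C. Comp C f (Ident C (Dom C f)) = f \<and> Comp C (Ident C (Cod C f)) f = f) \<and>
     (\<forall>f\<in>Arr C. \<forall>g\<in>Arr C. \<forall>h\<in>Arr C. Cod C f = Dom C g \<longrightarrow> Cod C g = Dom C h \<longrightarrow>
        Comp C h (Comp C g f) = Comp C (Comp C h g) f)"

definition is_iso :: "('o, 'a) cat \<Rightarrow> 'a \<Rightarrow> bool" where
  "is_iso C f \<longleftrightarrow> f \<in> Arr C \<and> (\<exists>g \<in> Hom C (Cod C f) (Dom C f).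
     Comp C g f = Ident C (Dom C f) \<and> Comp C f g = Ident C (Cod C f))"

record ('o, 'a, 'p, 'b) cfunctor =
  map_obj :: "'o \<Rightarrow> 'p"
  map_arr :: "'a \<Rightarrow> 'b"

definition is_functor ::
  "('o, 'a) cat \<Rightarrow> ('p, 'b) cat \<Rightarrow> ('o, 'a, 'p, 'b) cfunctor \<Rightarrow> bool" where
  "is_functor C D F \<longleftrightarrow> is_category C \<and> is_category D \<and>
     (\<forall>X\<in>Obj C. map_obj F X \<in> Obj D) \<and>
     (\<forall>f\<in>Arr C. map_arr F f \<in> Hom D (map_obj F (Dom C f)) (map_obj F (Cod C f))) \<and>
     (\<forall>X\<in>Obj C. map_arr F (Ident C X) = Ident D (map_obj F X)) \<and>
     (\<forall>f\<in>Arr C. \<forall>g\<in>Arr C. Cod C f = Dom C g \<longrightarrow>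
        map_arr F (Comp C g f) = Comp D (map_arr F g) (map_arr F f))"

definition id_functor :: "('o, 'a, 'o, 'a) cfunctor" where
  "id_functor = \<lparr>map_obj = (\<lambda>X. X), map_arr = (\<lambda>f. f)\<rparr>"

definition comp_functor ::
  "('p, 'b, 'q, 'c) cfunctor \<Rightarrow> ('o, 'a, 'p, 'b) cfunctor \<Rightarrow> ('o, 'a, 'q, 'c) cfunctor"
  (infixl \<open>\<circ>\<^sub>F\<close> 55) where
  "F' \<circ>\<^sub>F F = \<lparr>map_obj = map_obj F' \<circ> map_obj F, map_arr = map_arr F' \<circ> map_arr F\<rparr>"

text \<open>Strict equality of functors: the underlying HOL functions agree on the objects and arrows of
  the source category (their values elsewhere are irrelevant).\<close>

definition functor_eq ::
  "('o, 'a) cat \<Rightarrow> ('o, 'a, 'p, 'b) cfunctor \<Rightarrow> ('o, 'a, 'p, 'b) cfunctor \<Rightarrow> bool" where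
  "functor_eq C F F' \<longleftrightarrow>
     (\<forall>X\<in>Obj C. map_obj F X = map_obj F' X) \<and> (\<forall>f\<in>Arr C. map_arr F f = map_arr F' f)"

definition is_nat_trans ::
  "('o, 'a) cat \<Rightarrow> ('p, 'b) cat \<Rightarrow> ('o, 'a, 'p, 'b) cfunctor \<Rightarrow> ('o, 'a, 'p, 'b) cfunctor \<Rightarrow>
    ('o \<Rightarrow> 'b) \<Rightarrow> bool" where
  "is_nat_trans C D F F' \<tau> \<longleftrightarrow> is_functor C D F \<and> is_functor C D F' \<and>
     (\<forall>X\<in>Obj C. \<tau> X \<in> Hom D (map_obj F X) (map_obj F' X)) \<and>
     (\<forall>f\<in>Arr C. Comp D (\<tau> (Cod C f)) (map_arr F f) = Comp D (map_arr F' f) (\<tau> (Dom C f)))"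

definition is_nat_iso ::
  "('o, 'a) cat \<Rightarrow> ('p, 'b) cat \<Rightarrow> ('o, 'a, 'p, 'b) cfunctor \<Rightarrow> ('o, 'a, 'p, 'b) cfunctor \<Rightarrow>
    ('o \<Rightarrow> 'b) \<Rightarrow> bool" where
  "is_nat_iso C D F F' \<tau> \<longleftrightarrow> is_nat_trans C D F F' \<tau> \<and> (\<forall>X\<in>Obj C. is_iso D (\<tau> X))"

definition is_equivalence ::
  "('o, 'a) cat \<Rightarrow> ('p, 'b) cat \<Rightarrow> ('o, 'a, 'p, 'b) cfunctor \<Rightarrow> bool" where
  "is_equivalence C D F \<longleftrightarrow> is_functor C D F \<and>
     (\<exists>Q \<alpha> \<beta>. is_functor D C Q \<and>
        is_nat_iso C C id_functor (Q \<circ>\<^sub>F F) \<alpha> \<and> is_nat_iso D D (F \<circ>\<^sub>F Q) id_functor \<beta>)"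

definition is_adjunction ::
  "('o, 'a) cat \<Rightarrow> ('p, 'b) cat \<Rightarrow> ('o, 'a, 'p, 'b) cfunctor \<Rightarrow> ('p, 'b, 'o, 'a) cfunctor \<Rightarrow>
    ('o \<Rightarrow> 'a) \<Rightarrow> ('p \<Rightarrow> 'b) \<Rightarrow> bool" where
  "is_adjunction C D L R \<eta> \<epsilon> \<longleftrightarrow> is_functor C D L \<and> is_functor D C R \<and>
     is_nat_trans C C id_functor (R \<circ>\<^sub>F L) \<eta> \<and>
     is_nat_trans D D (L \<circ>\<^sub>F R) id_functor \<epsilon> \<and>
     (\<forall>X\<in>Obj C. Comp D (\<epsilon> (map_obj L X)) (map_arr L (\<eta> X)) = Ident D (map_obj L X)) \<and>
     (\<forall>Z\<in>Obj D. Comp C (map_arr R (\<epsilon> Z)) (\<eta> (map_obj R Z)) = Ident C (map_obj R Z))"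


section \<open>Monads and their modules\<close>

record ('o, 'a) cmonad =
  Endo :: "('o, 'a, 'o, 'a) cfunctor"
  mon_unit :: "'o \<Rightarrow> 'a"
  mon_mult :: "'o \<Rightarrow> 'a"

definition is_monad :: "('o, 'a) cat \<Rightarrow> ('o, 'a) cmonad \<Rightarrow> bool" where
  "is_monad C A \<longleftrightarrow>
     is_nat_trans C C id_functor (Endo A) (mon_unit A) \<and>
     is_nat_trans C C (Endo A \<circ>\<^sub>F Endo A) (Endo A) (mon_mult A) \<and>
     (\<forall>X\<in>Obj C.
        Comp C (mon_mult A X) (map_arr (Endo A) (mon_mult A X)) =
          Comp C (mon_mult A X) (mon_mult A (map_obj (Endo A) X)) \<and>
        Comp C (mon_mult A X) (map_arr (Endo A) (mon_unit A X)) = Ident C (map_obj (Endo A) X) \<and>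
        Comp C (mon_mult A X) (mon_unit A (map_obj (Endo A) X)) = Ident C (map_obj (Endo A) X))"

definition monad_of_adjunction ::
  "('o, 'a, 'p, 'b) cfunctor \<Rightarrow> ('p, 'b, 'o, 'a) cfunctor \<Rightarrow> ('o \<Rightarrow> 'a) \<Rightarrow> ('p \<Rightarrow> 'b) \<Rightarrow>
    ('o, 'a) cmonad" where
  "monad_of_adjunction L R \<eta> \<epsilon> =
     \<lparr>Endo = R \<circ>\<^sub>F L, mon_unit = \<eta>, mon_mult = (\<lambda>X. map_arr R (\<epsilon> (map_obj L X)))\<rparr>"

definition monad_modules :: "('o, 'a) cat \<Rightarrow> ('o, 'a) cmonad \<Rightarrow> ('o \<times> 'a) set" where
  "monad_modules C A =
     {(X, \<rho>). X \<in> Obj C \<and> \<rho> \<in> Hom C (map_obj (Endo A) X) X \<and>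
        Comp C \<rho> (map_arr (Endo A) \<rho>) = Comp C \<rho> (mon_mult A X) \<and>
        Comp C \<rho> (mon_unit A X) = Ident C X}"

text \<open>An arrow of the category of modules over a monad is a triple (source, underlying arrow,
  target).\<close>

definition monad_module_cat ::
  "('o, 'a) cat \<Rightarrow> ('o, 'a) cmonad \<Rightarrow>
    ('o \<times> 'a, ('o \<times> 'a) \<times> 'a \<times> ('o \<times> 'a)) cat" where
  "monad_module_cat C A =
     \<lparr>Obj = monad_modules C A,
      Arr = {((X, \<rho>), f, (Y, \<sigma>)) | X \<rho> f Y \<sigma>.
               (X, \<rho>) \<in> monad_modules C A \<and> (Y, \<sigma>) \<in> monad_modules C A \<and> f \<in> Hom C X Y \<and>
               Comp C f \<rho> = Comp C \<sigma> (map_arr (Endo A) f)},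
      Dom = (\<lambda>(M, f, N). M),
      Cod = (\<lambda>(M, f, N). N),
      Ident = (\<lambda>M. (M, Ident C (fst M), M)),
      Comp = (\<lambda>(N', g, P) (M, f, N). (M, Comp C g f, P))\<rparr>"

definition extension_functor ::
  "('o, 'a) cat \<Rightarrow> ('o, 'a) cmonad \<Rightarrow>
    ('o, 'a, 'o \<times> 'a, ('o \<times> 'a) \<times> 'a \<times> ('o \<times> 'a)) cfunctor" where
  "extension_functor C A =
     (let F = (\<lambda>Y. (map_obj (Endo A) Y, mon_mult A Y)) in
      \<lparr>map_obj = F, map_arr = (\<lambda>f. (F (Dom C f), map_arr (Endo A) f, F (Cod C f)))\<rparr>)"

definition forgetful_functor ::
  "('o \<times> 'a, ('o \<times> 'a) \<times> 'a \<times> ('o \<times> 'a), 'o, 'a) cfunctor" where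
  "forgetful_functor = \<lparr>map_obj = (\<lambda>(X, \<rho>). X), map_arr = (\<lambda>(M, f, N). f)\<rparr>"

definition eilenberg_moore_functor ::
  "('p, 'b) cat \<Rightarrow> ('p, 'b, 'o, 'a) cfunctor \<Rightarrow> ('p \<Rightarrow> 'b) \<Rightarrow>
    ('p, 'b, 'o \<times> 'a, ('o \<times> 'a) \<times> 'a \<times> ('o \<times> 'a)) cfunctor" where
  "eilenberg_moore_functor D R \<epsilon> =
     (let E = (\<lambda>Z. (map_obj R Z, map_arr R (\<epsilon> Z))) in
      \<lparr>map_obj = E, map_arr = (\<lambda>f. (E (Dom D f), map_arr R f, E (Cod D f)))\<rparr>)"


section \<open>Left modules over a ring\<close>

text \<open>The library's locale \<^locale>\<open>module\<close> requires the ring to be commutative; the following has the same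
  axioms without that restriction. The fields \<open>mult\<close> and \<open>one\<close> of the record type are not used.\<close>

locale left_module = R?: ring R + M?: abelian_group M
  for R :: "('r, 'm) ring_scheme" (structure) and M :: "('r, 'b, 'n) module_scheme" (structure) +
  assumes smult_closed: "\<lbrakk>a \<in> carrier R; x \<in> carrier M\<rbrakk> \<Longrightarrow> a \<odot>\<^bsub>M\<^esub> x \<in> carrier M"
    and smult_l_distr: "\<lbrakk>a \<in> carrier R; b \<in> carrier R; x \<in> carrier M\<rbrakk> \<Longrightarrow>
      (a \<oplus>\<^bsub>R\<^esub> b) \<odot>\<^bsub>M\<^esub> x = a \<odot>\<^bsub>M\<^esub> x \<oplus>\<^bsub>M\<^esub> b \<odot>\<^bsub>M\<^esub> x"
    and smult_r_distr: "\<lbrakk>a \<in> carrier R; x \<in> carrier M; y \<in> carrier M\<rbrakk> \<Longrightarrow>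
      a \<odot>\<^bsub>M\<^esub> (x \<oplus>\<^bsub>M\<^esub> y) = a \<odot>\<^bsub>M\<^esub> x \<oplus>\<^bsub>M\<^esub> a \<odot>\<^bsub>M\<^esub> y"
    and smult_assoc: "\<lbrakk>a \<in> carrier R; b \<in> carrier R; x \<in> carrier M\<rbrakk> \<Longrightarrow>
      (a \<otimes>\<^bsub>R\<^esub> b) \<odot>\<^bsub>M\<^esub> x = a \<odot>\<^bsub>M\<^esub> (b \<odot>\<^bsub>M\<^esub> x)"
    and smult_one: "x \<in> carrier M \<Longrightarrow> \<one>\<^bsub>R\<^esub> \<odot>\<^bsub>M\<^esub> x = x"

definition lmod_hom ::
  "('r, 'm) ring_scheme \<Rightarrow> ('r, 'a) module \<Rightarrow> ('r, 'b) module \<Rightarrow> ('a \<Rightarrow> 'b) set" where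
  "lmod_hom R M N =
     {f \<in> carrier M \<rightarrow>\<^sub>E carrier N.
        (\<forall>x\<in>carrier M. \<forall>y\<in>carrier M. f (x \<oplus>\<^bsub>M\<^esub> y) = f x \<oplus>\<^bsub>N\<^esub> f y) \<and>
        (\<forall>a\<in>carrier R. \<forall>x\<in>carrier M. f (a \<odot>\<^bsub>M\<^esub> x) = a \<odot>\<^bsub>N\<^esub> f x)}"

text \<open>The category of all left \<open>R\<close>-modules whose carrier is a subset of the type \<open>'u\<close>, which plays
  the role of a universe. Arrows are triples (source, extensional homomorphism, target).\<close>

type_synonym ('r, 'u) mod_arr = "('r, 'u) module \<times> ('u \<Rightarrow> 'u) \<times> ('r, 'u) module"

definition module_cat ::
  "('r, 'm) ring_scheme \<Rightarrow> (('r, 'u) module, ('r, 'u) mod_arr) cat" where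
  "module_cat R =
     \<lparr>Obj = {M. left_module R M},
      Arr = {(M, f, N). left_module R M \<and> left_module R N \<and> f \<in> lmod_hom R M N},
      Dom = (\<lambda>(M, f, N). M),
      Cod = (\<lambda>(M, f, N). N),
      Ident = (\<lambda>M. (M, \<lambda>x\<in>carrier M. x, M)),
      Comp = (\<lambda>(N', g, P) (M, f, N). (M, compose (carrier M) g f, P))\<rparr>"

definition regular_module :: "('r, 'm) ring_scheme \<Rightarrow> ('r, 'r) module" where
  "regular_module R =
     \<lparr>carrier = carrier R, mult = mult R, one = one R, zero = zero R, add = add R,
      smult = mult R\<rparr>"

definition res_module :: "('r, 'm) ring_scheme \<Rightarrow> ('r, 'a) module \<Rightarrow> ('r, 'a) module" where
  "res_module S M = M\<lparr>smult := restrict (smult M) (carrier S)\<rparr>"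

text \<open>The \<open>R\<close>-module of \<open>S\<close>-linear maps from \<open>R\<close> to \<open>W\<close>, for a subring \<open>S\<close> of \<open>R\<close>; the left action
  of \<open>R\<close> comes from right multiplication, \<open>(a f)(x) = f (x a)\<close>.\<close>

definition hom_module ::
  "('r, 'm) ring_scheme \<Rightarrow> ('r, 'n) ring_scheme \<Rightarrow> ('r, 'u) module \<Rightarrow> ('r, 'r \<Rightarrow> 'u) module" where
  "hom_module R S W =
     \<lparr>carrier = lmod_hom S (res_module S (regular_module R)) W,
      mult = undefined, one = undefined,
      zero = (\<lambda>x\<in>carrier R. \<zero>\<^bsub>W\<^esub>),
      add = (\<lambda>f g. \<lambda>x\<in>carrier R. f x \<oplus>\<^bsub>W\<^esub> g x),
      smult = (\<lambda>a f. \<lambda>x\<in>carrier R. f (x \<otimes>\<^bsub>R\<^esub> a))\<rparr>"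

text \<open>Elements of \<^const>\<open>hom_module\<close> have type \<open>'r \<Rightarrow> 'u\<close> rather than \<open>'u\<close>. To obtain a functor between
  module categories on the same universe, the module is transported along an injection
  \<open>enc\<close> of \<open>'r \<Rightarrow> 'u\<close> into \<open>'u\<close>, i.e. \<open>'u\<close> is a universe closed under forming functions on \<open>'r\<close>.\<close>

definition transport_module :: "('a \<Rightarrow> 'b) \<Rightarrow> ('r, 'a) module \<Rightarrow> ('r, 'b) module" where
  "transport_module enc M =
     \<lparr>carrier = enc ` carrier M,
      mult = undefined, one = undefined,
      zero = enc \<zero>\<^bsub>M\<^esub>,
      add = (\<lambda>u v. enc (inv_into UNIV enc u \<oplus>\<^bsub>M\<^esub> inv_into UNIV enc v)),
      smult = (\<lambda>a u. enc (a \<odot>\<^bsub>M\<^esub> inv_into UNIV enc u))\<rparr>"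

definition coind_module ::
  "('r, 'm) ring_scheme \<Rightarrow> ('r, 'n) ring_scheme \<Rightarrow> (('r \<Rightarrow> 'u) \<Rightarrow> 'u) \<Rightarrow>
    ('r, 'u) module \<Rightarrow> ('r, 'u) module" where
  "coind_module R S enc W = transport_module enc (hom_module R S W)"

text \<open>Such universes exist above every type \<open>'b\<close>: the type \<open>'r list \<Rightarrow> 'b\<close> contains a copy of \<open>'b\<close>
  and admits an \<open>enc\<close>. Hence every module is isomorphic to one living in such a universe.\<close>

lemma universe_exists:
  "\<exists>(enc :: ('r \<Rightarrow> ('r list \<Rightarrow> 'b)) \<Rightarrow> ('r list \<Rightarrow> 'b)) (emb :: 'b \<Rightarrow> ('r list \<Rightarrow> 'b)).
     inj enc \<and> inj emb"
proof -
  have "inj (\<lambda>(F :: 'r \<Rightarrow> 'r list \<Rightarrow> 'b) l. F (hd l) (tl l))"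
  proof (rule injI)
    fix F F' :: "'r \<Rightarrow> 'r list \<Rightarrow> 'b"
    assume eq: "(\<lambda>l. F (hd l) (tl l)) = (\<lambda>l. F' (hd l) (tl l))"
    have "F x l = F' x l" for x l
      using fun_cong[OF eq, of "x # l"] by simp
    then show "F = F'" by blast
  qed
  moreover have "inj (\<lambda>(b :: 'b) (l :: 'r list). b)"
    by (rule injI) (rule fun_cong)
  ultimately show ?thesis by blast
qed


section \<open>Group algebras, restriction and coinduction\<close>

text \<open>Elements of the group algebra are finitely supported functions, extended by zero outside
  the group. Thus, for a subgroup \<open>H\<close>, the group algebra of \<open>H\<close> is literally a subset of that of
  \<open>G\<close>.\<close>

definition group_algebra ::
  "('k, 'm) ring_scheme \<Rightarrow> ('g, 'n) monoid_scheme \<Rightarrow> ('g \<Rightarrow> 'k) ring" where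
  "group_algebra k G =
     \<lparr>carrier = {a. (\<forall>x. a x \<in> carrier k) \<and> (\<forall>x. x \<notin> carrier G \<longrightarrow> a x = \<zero>\<^bsub>k\<^esub>) \<and>
                    finite {x. a x \<noteq> \<zero>\<^bsub>k\<^esub>}},
      mult = (\<lambda>a b x. if x \<in> carrier G
                then \<Oplus>\<^bsub>k\<^esub>y\<in>{y. a y \<noteq> \<zero>\<^bsub>k\<^esub>}. a y \<otimes>\<^bsub>k\<^esub> b (inv\<^bsub>G\<^esub> y \<otimes>\<^bsub>G\<^esub> x) else \<zero>\<^bsub>k\<^esub>),
      one = (\<lambda>x. if x = \<one>\<^bsub>G\<^esub> then \<one>\<^bsub>k\<^esub> else \<zero>\<^bsub>k\<^esub>),
      zero = (\<lambda>x. \<zero>\<^bsub>k\<^esub>),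
      add = (\<lambda>a b x. a x \<oplus>\<^bsub>k\<^esub> b x)\<rparr>"

abbreviation subgroup_algebra ::
  "('k, 'm) ring_scheme \<Rightarrow> ('g, 'n) monoid_scheme \<Rightarrow> 'g set \<Rightarrow> ('g \<Rightarrow> 'k) ring" where
  "subgroup_algebra k G H \<equiv> group_algebra k (G\<lparr>carrier := H\<rparr>)"

definition Res ::
  "('k, 'm) ring_scheme \<Rightarrow> ('g, 'n) monoid_scheme \<Rightarrow> 'g set \<Rightarrow>
    (('g \<Rightarrow> 'k, 'u) module, ('g \<Rightarrow> 'k, 'u) mod_arr,
     ('g \<Rightarrow> 'k, 'u) module, ('g \<Rightarrow> 'k, 'u) mod_arr) cfunctor" where
  "Res k G H =
     (let r = res_module (subgroup_algebra k G H) in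
      \<lparr>map_obj = r, map_arr = (\<lambda>(V, f, V'). (r V, f, r V'))\<rparr>)"

definition CoInd ::
  "('k, 'm) ring_scheme \<Rightarrow> ('g, 'n) monoid_scheme \<Rightarrow> 'g set \<Rightarrow>
    ((('g \<Rightarrow> 'k) \<Rightarrow> 'u) \<Rightarrow> 'u) \<Rightarrow>
    (('g \<Rightarrow> 'k, 'u) module, ('g \<Rightarrow> 'k, 'u) mod_arr,
     ('g \<Rightarrow> 'k, 'u) module, ('g \<Rightarrow> 'k, 'u) mod_arr) cfunctor" where
  "CoInd k G H enc =
     (let c = coind_module (group_algebra k G) (subgroup_algebra k G H) enc in
      \<lparr>map_obj = c,
       map_arr = (\<lambda>(W, f, W').
         (c W, \<lambda>u\<in>carrier (c W). enc (\<lambda>x\<in>carrier (group_algebra k G). f (inv_into UNIV enc u x)), c W'))\<rparr>)"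

definition res_coind_unit ::
  "('k, 'm) ring_scheme \<Rightarrow> ('g, 'n) monoid_scheme \<Rightarrow> 'g set \<Rightarrow>
    ((('g \<Rightarrow> 'k) \<Rightarrow> 'u) \<Rightarrow> 'u) \<Rightarrow> ('g \<Rightarrow> 'k, 'u) module \<Rightarrow> ('g \<Rightarrow> 'k, 'u) mod_arr" where
  "res_coind_unit k G H enc V =
     (V, \<lambda>v\<in>carrier V. enc (\<lambda>x\<in>carrier (group_algebra k G). x \<odot>\<^bsub>V\<^esub> v),
      map_obj (CoInd k G H enc \<circ>\<^sub>F Res k G H) V)"

definition res_coind_counit ::
  "('k, 'm) ring_scheme \<Rightarrow> ('g, 'n) monoid_scheme \<Rightarrow> 'g set \<Rightarrow>
    ((('g \<Rightarrow> 'k) \<Rightarrow> 'u) \<Rightarrow> 'u) \<Rightarrow> ('g \<Rightarrow> 'k, 'u) module \<Rightarrow> ('g \<Rightarrow> 'k, 'u) mod_arr" where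
  "res_coind_counit k G H enc W =
     (map_obj (Res k G H \<circ>\<^sub>F CoInd k G H enc) W,
      \<lambda>u\<in>carrier (map_obj (CoInd k G H enc) W). inv_into UNIV enc u \<one>\<^bsub>group_algebra k G\<^esub>,
      W)"

definition coind_monad ::
  "('k, 'm) ring_scheme \<Rightarrow> ('g, 'n) monoid_scheme \<Rightarrow> 'g set \<Rightarrow>
    ((('g \<Rightarrow> 'k) \<Rightarrow> 'u) \<Rightarrow> 'u) \<Rightarrow>
    (('g \<Rightarrow> 'k, 'u) module, ('g \<Rightarrow> 'k, 'u) mod_arr) cmonad" where
  "coind_monad k G H enc =
     monad_of_adjunction (Res k G H) (CoInd k G H enc)
       (res_coind_unit k G H enc) (res_coind_counit k G H enc)"

end

theory Submission
  imports Defs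
begin

text \<open>
  The theorem is an instance of a separability argument. Let \<open>L\<close> be left adjoint to \<open>R\<close>, with
  values in a category \<open>D\<close>. If every counit \<open>\<epsilon>\<^sub>Z : L (R Z) \<rightarrow> Z\<close> has a section \<open>\<sigma>\<^sub>Z\<close>, natural in \<open>Z\<close>,
  and idempotents split in \<open>D\<close>, then the Eilenberg-Moore functor of the adjunction is an equivalence
  (\<open>eilenberg_moore_equivalence_if_counit_splits\<close>). Indeed the section recovers an arrow \<open>f\<close> from \<open>R f\<close>
  as \<open>\<epsilon> \<circ> L (R f) \<circ> \<sigma>\<close>, and the same formula turns any arrow of modules into an arrow of \<open>D\<close>; so the
  functor is fully faithful. A module \<open>(X, \<rho>)\<close> comes from a direct summand of \<open>L X\<close>, namely the image
  of the idempotent \<open>L \<rho> \<circ> \<sigma>\<close>. Every module is thus a direct summand of a free one, so splitting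
  idempotents replaces the coequalizers of the general monadicity theorem.

  For rings \<open>S \<subseteq> R\<close>, the counit of restriction and coinduction is evaluation of \<open>S\<close>-linear maps
  \<open>R \<rightarrow> W\<close> at \<open>1\<close>. A map \<open>\<pi> : R \<rightarrow> S\<close> that is linear over \<open>S\<close> on both sides and fixes \<open>1\<close> gives the
  natural section \<open>w \<mapsto> (x \<mapsto> \<pi>(x) w)\<close> (\<open>coinduction_monadic_if_bimodule_retract\<close>). Idempotents of
  modules split through their images, which are subsets of the given carrier, so the splitting stays
  in the same universe.

  Finally, for a subgroup \<open>H\<close> of \<open>G\<close> the map \<open>\<pi>\<close> that cuts a finitely supported function on \<open>G\<close> off
  outside \<open>H\<close> has these properties, since \<open>H\<close> and its complement are both stable under translation by
  \<open>H\<close> from either side (\<open>cutoff_mult_left\<close>, \<open>cutoff_mult_right\<close>).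
\<close>

section \<open>Calculating in categories\<close>

lemma HomD:
  assumes "f \<in> Hom C X Y"
  shows "f \<in> Arr C" "Dom C f = X" "Cod C f = Y"
  using assms by (auto simp: Hom_def)

lemma map_comp_functor [simp]:
  "map_obj (F' \<circ>\<^sub>F F) X = map_obj F' (map_obj F X)"
  "map_arr (F' \<circ>\<^sub>F F) f = map_arr F' (map_arr F f)"
  by (simp_all add: comp_functor_def)

lemma map_id_functor [simp]: "map_obj id_functor X = X" "map_arr id_functor f = f"
  by (simp_all add: id_functor_def)

locale category =
  fixes C :: "('o, 'a) cat"
  assumes is_category: "is_category C"
begin

lemma dom_obj [simp]: "f \<in> Arr C \<Longrightarrow> Dom C f \<in> Obj C"
  and cod_obj [simp]: "f \<in> Arr C \<Longrightarrow> Cod C f \<in> Obj C"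
  using is_category by (auto simp: is_category_def)

lemma ident_simps [simp]:
  assumes "X \<in> Obj C"
  shows "Ident C X \<in> Arr C" "Dom C (Ident C X) = X" "Cod C (Ident C X) = X"
  using is_category assms by (auto simp: is_category_def Hom_def)

lemma comp_simps [simp]:
  assumes "f \<in> Arr C" "g \<in> Arr C" "Cod C f = Dom C g"
  shows "Comp C g f \<in> Arr C" "Dom C (Comp C g f) = Dom C f" "Cod C (Comp C g f) = Cod C g"
  using is_category assms by (auto simp: is_category_def Hom_def)

lemma comp_ident [simp]:
  assumes "f \<in> Arr C"
  shows "Dom C f = X \<Longrightarrow> Comp C f (Ident C X) = f" "Cod C f = Y \<Longrightarrow> Comp C (Ident C Y) f = f"
  using is_category assms by (auto simp: is_category_def)

lemma assoc:
  assumes "f \<in> Arr C" "g \<in> Arr C" "h \<in> Arr C" "Cod C f = Dom C g" "Cod C g = Dom C h"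
  shows "Comp C (Comp C h g) f = Comp C h (Comp C g f)"
  using is_category assms by (auto simp: is_category_def)

text \<open>Composites are kept bracketed to the right by \<open>assoc\<close>; this lemma lets an equation
  \<open>g f = k\<close> act inside such a composite.\<close>

lemma comp_left_cong:
  assumes "Comp C g f = k"
    and "h \<in> Arr C" "f \<in> Arr C" "g \<in> Arr C" "Cod C h = Dom C f" "Cod C f = Dom C g"
  shows "Comp C g (Comp C f h) = Comp C k h"
  using assms assoc[of h f g] by simp

lemma is_isoI:
  assumes "f \<in> Arr C" "g \<in> Arr C" "Dom C g = Cod C f" "Cod C g = Dom C f"
    and "Comp C g f = Ident C (Dom C f)" "Comp C f g = Ident C (Cod C f)"
  shows "is_iso C f"
  using assms by (auto simp: is_iso_def Hom_def)

lemma is_isoE: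
  assumes "is_iso C f"
  obtains g where "g \<in> Arr C" "Dom C g = Cod C f" "Cod C g = Dom C f"
    "Comp C g f = Ident C (Dom C f)" "Comp C f g = Ident C (Cod C f)"
  using assms by (auto simp: is_iso_def Hom_def)

end

locale cat_functor = C: category C + D: category D
  for C :: "('o, 'a) cat" and D :: "('p, 'b) cat" +
  fixes F :: "('o, 'a, 'p, 'b) cfunctor"
  assumes is_functor: "is_functor C D F"
begin

lemma map_obj_obj [simp]: "X \<in> Obj C \<Longrightarrow> map_obj F X \<in> Obj D"
  using is_functor by (simp add: is_functor_def)

lemma map_arr_simps [simp]:
  assumes "f \<in> Arr C"
  shows "map_arr F f \<in> Arr D" "Dom D (map_arr F f) = map_obj F (Dom C f)"
    "Cod D (map_arr F f) = map_obj F (Cod C f)"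
  using is_functor assms by (auto simp: is_functor_def Hom_def)

lemma map_ident [simp]: "X \<in> Obj C \<Longrightarrow> map_arr F (Ident C X) = Ident D (map_obj F X)"
  using is_functor by (simp add: is_functor_def)

lemma map_comp [simp]:
  "f \<in> Arr C \<Longrightarrow> g \<in> Arr C \<Longrightarrow> Cod C f = Dom C g \<Longrightarrow>
    map_arr F (Comp C g f) = Comp D (map_arr F g) (map_arr F f)"
  using is_functor by (simp add: is_functor_def)

end

lemma cat_functorI: "is_functor C D F \<Longrightarrow> cat_functor C D F"
  by (simp add: cat_functor_def category_def cat_functor_axioms_def is_functor_def)

lemma is_functor_comp:
  assumes "is_functor C D F" "is_functor D B F'"
  shows "is_functor C B (F' \<circ>\<^sub>F F)"
proof -
  interpret F: cat_functor C D F using assms(1) by (rule cat_functorI)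
  interpret F': cat_functor D B F' using assms(2) by (rule cat_functorI)
  show ?thesis
    using F.C.is_category F'.D.is_category by (auto simp: is_functor_def Hom_def)
qed

lemma is_functor_id: "is_category C \<Longrightarrow> is_functor C C id_functor"
  by (auto simp: is_functor_def Hom_def is_category_def)

lemma is_nat_transD:
  assumes "is_nat_trans C D F F' \<tau>"
  shows "X \<in> Obj C \<Longrightarrow> \<tau> X \<in> Arr D"
    and "X \<in> Obj C \<Longrightarrow> Dom D (\<tau> X) = map_obj F X"
    and "X \<in> Obj C \<Longrightarrow> Cod D (\<tau> X) = map_obj F' X"
    and "f \<in> Arr C \<Longrightarrow> Dom C f = X \<Longrightarrow> Cod C f = Y \<Longrightarrow>
      Comp D (\<tau> Y) (map_arr F f) = Comp D (map_arr F' f) (\<tau> X)"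
  using assms by (auto simp: is_nat_trans_def Hom_def)


section \<open>Fully faithful, essentially surjective functors are equivalences\<close>

text \<open>Choosing a preimage up to isomorphism for every object of the target gives the quasi-inverse on
  objects; full faithfulness transports arrows. Every equation in the source category is then checked
  after applying the faithful functor \<open>F\<close>, where the chosen isomorphisms cancel.\<close>

lemma (in cat_functor) equivalence_if_fully_faithful_ess_surj:
  assumes faithful: "\<And>f g. f \<in> Arr C \<Longrightarrow> g \<in> Arr C \<Longrightarrow> Dom C f = Dom C g \<Longrightarrow> Cod C f = Cod C g \<Longrightarrow>
      map_arr F f = map_arr F g \<Longrightarrow> f = g"
    and full: "\<And>X Y g. X \<in> Obj C \<Longrightarrow> Y \<in> Obj C \<Longrightarrow> g \<in> Hom D (map_obj F X) (map_obj F Y) \<Longrightarrow>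
      \<exists>f\<in>Hom C X Y. map_arr F f = g"
    and ess_surj: "\<And>Y. Y \<in> Obj D \<Longrightarrow> \<exists>X\<in>Obj C. \<exists>b\<in>Hom D (map_obj F X) Y. is_iso D b"
  shows "is_equivalence C D F"
proof -
  define inverse_pair where "inverse_pair Y X b b' \<longleftrightarrow>
      X \<in> Obj C \<and> b \<in> Arr D \<and> Dom D b = map_obj F X \<and> Cod D b = Y \<and>
      b' \<in> Arr D \<and> Dom D b' = Y \<and> Cod D b' = map_obj F X \<and>
      Comp D b' b = Ident D (map_obj F X) \<and> Comp D b b' = Ident D Y" for Y X b b'
  have "\<exists>X b b'. inverse_pair Y X b b'" if Y: "Y \<in> Obj D" for Y
  proof -
    obtain X b where "X \<in> Obj C" "b \<in> Hom D (map_obj F X) Y" "is_iso D b"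
      using ess_surj[OF Y] by blast
    moreover from \<open>is_iso D b\<close> obtain b' where "b' \<in> Arr D" "Dom D b' = Cod D b"
      "Cod D b' = Dom D b" "Comp D b' b = Ident D (Dom D b)" "Comp D b b' = Ident D (Cod D b)"
      by (rule D.is_isoE)
    ultimately have "inverse_pair Y X b b'" by (auto simp: inverse_pair_def Hom_def)
    then show ?thesis by blast
  qed
  then obtain q b b' where pair: "\<And>Y. Y \<in> Obj D \<Longrightarrow> inverse_pair Y (q Y) (b Y) (b' Y)"
    by metis
  have q [simp]: "q Y \<in> Obj C"
    and b [simp]: "b Y \<in> Arr D" "Dom D (b Y) = map_obj F (q Y)" "Cod D (b Y) = Y"
    and b' [simp]: "b' Y \<in> Arr D" "Dom D (b' Y) = Y" "Cod D (b' Y) = map_obj F (q Y)"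
    and b'b [simp]: "Comp D (b' Y) (b Y) = Ident D (map_obj F (q Y))"
    and bb' [simp]: "Comp D (b Y) (b' Y) = Ident D Y"
    if "Y \<in> Obj D" for Y
    using pair[OF that] by (simp_all add: inverse_pair_def)
  \<comment> \<open>\<open>lift X Y g\<close> is the unique preimage of an arrow \<open>g\<close> from \<open>F X\<close> to \<open>F Y\<close>.\<close>
  define lift where "lift X Y g = (SOME f. f \<in> Hom C X Y \<and> map_arr F f = g)" for X Y g
  have lift [simp]: "lift X Y g \<in> Arr C" "Dom C (lift X Y g) = X" "Cod C (lift X Y g) = Y"
      "map_arr F (lift X Y g) = g"
    if "X \<in> Obj C" "Y \<in> Obj C" "g \<in> Arr D" "Dom D g = map_obj F X" "Cod D g = map_obj F Y"
    for X Y g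
  proof -
    have "\<exists>f. f \<in> Hom C X Y \<and> map_arr F f = g"
      using full[of X Y g] that by (auto simp: Hom_def)
    from someI_ex[OF this] show "lift X Y g \<in> Arr C" "Dom C (lift X Y g) = X"
      "Cod C (lift X Y g) = Y" "map_arr F (lift X Y g) = g"
      by (auto simp: lift_def Hom_def)
  qed
  have cancel [simp]: "Comp D (b Y) (Comp D (b' Y) h) = h" if "h \<in> Arr D" "Cod D h = Y" for h Y
    using that by (auto simp: D.assoc[symmetric])
  define Q :: "('p, 'b, 'o, 'a) cfunctor" where
    "Q = \<lparr>map_obj = q, map_arr = (\<lambda>f. lift (q (Dom D f)) (q (Cod D f))
        (Comp D (b' (Cod D f)) (Comp D f (b (Dom D f)))))\<rparr>"
  have Q_obj [simp]: "map_obj Q Y = q Y" for Y by (simp add: Q_def)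
  have Q_arr [simp]: "map_arr Q f \<in> Arr C" "Dom C (map_arr Q f) = q (Dom D f)"
      "Cod C (map_arr Q f) = q (Cod D f)"
      "map_arr F (map_arr Q f) = Comp D (b' (Cod D f)) (Comp D f (b (Dom D f)))"
    if "f \<in> Arr D" for f using that by (simp_all add: Q_def)
  have Q: "is_functor D C Q"
    unfolding is_functor_def
  proof (intro conjI ballI impI)
    fix f g assume fg: "f \<in> Arr D" "g \<in> Arr D" "Cod D f = Dom D g"
    show "map_arr Q (Comp D g f) = Comp C (map_arr Q g) (map_arr Q f)"
      by (rule faithful) (use fg in \<open>simp_all add: D.assoc\<close>)
  next
    fix Y assume Y: "Y \<in> Obj D"
    show "map_arr Q (Ident D Y) = Ident C (map_obj Q Y)"
      by (rule faithful) (use Y in simp_all)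
  qed (simp_all add: C.is_category D.is_category Hom_def)
  have FQ: "is_functor D D (F \<circ>\<^sub>F Q)" by (rule is_functor_comp[OF Q is_functor])
  have QF: "is_functor C C (Q \<circ>\<^sub>F F)" by (rule is_functor_comp[OF is_functor Q])
  have \<beta>: "is_nat_iso D D (F \<circ>\<^sub>F Q) id_functor b"
    unfolding is_nat_iso_def is_nat_trans_def
  proof (intro conjI ballI)
    fix Y assume "Y \<in> Obj D"
    then show "is_iso D (b Y)" by (intro D.is_isoI[where g = "b' Y"]) simp_all
  qed (use FQ is_functor_id[OF D.is_category] in \<open>simp_all add: Hom_def\<close>)
  \<comment> \<open>The unit of the equivalence is the preimage of the chosen isomorphism at \<open>F X\<close>.\<close>
  define \<alpha> where "\<alpha> X = lift X (q (map_obj F X)) (b' (map_obj F X))" for X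
  define \<alpha>' where "\<alpha>' X = lift (q (map_obj F X)) X (b (map_obj F X))" for X
  have \<alpha>_simps [simp]: "\<alpha> X \<in> Arr C" "Dom C (\<alpha> X) = X" "Cod C (\<alpha> X) = q (map_obj F X)"
      "map_arr F (\<alpha> X) = b' (map_obj F X)" if "X \<in> Obj C" for X
    using that by (simp_all add: \<alpha>_def)
  have \<alpha>'_simps [simp]: "\<alpha>' X \<in> Arr C" "Dom C (\<alpha>' X) = q (map_obj F X)" "Cod C (\<alpha>' X) = X"
      "map_arr F (\<alpha>' X) = b (map_obj F X)" if "X \<in> Obj C" for X
    using that by (simp_all add: \<alpha>'_def)
  have \<alpha>: "is_nat_iso C C id_functor (Q \<circ>\<^sub>F F) \<alpha>"
    unfolding is_nat_iso_def is_nat_trans_def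
  proof (intro conjI ballI)
    fix X assume X: "X \<in> Obj C"
    show "is_iso C (\<alpha> X)"
    proof (rule C.is_isoI[where g = "\<alpha>' X"])
      show "Comp C (\<alpha>' X) (\<alpha> X) = Ident C (Dom C (\<alpha> X))"
        by (rule faithful) (use X in simp_all)
      show "Comp C (\<alpha> X) (\<alpha>' X) = Ident C (Cod C (\<alpha> X))"
        by (rule faithful) (use X in simp_all)
    qed (use X in simp_all)
  next
    fix f assume f: "f \<in> Arr C"
    show "Comp C (\<alpha> (Cod C f)) (map_arr id_functor f) = Comp C (map_arr (Q \<circ>\<^sub>F F) f) (\<alpha> (Dom C f))"
      by (rule faithful) (use f in \<open>simp_all add: D.assoc\<close>)
  qed (use QF is_functor_id[OF C.is_category] in \<open>simp_all add: Hom_def\<close>)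
  show ?thesis using is_functor Q \<alpha> \<beta> by (auto simp: is_equivalence_def)
qed


section \<open>Adjunctions, monads and the Eilenberg-Moore functor\<close>

locale adjunction = L: cat_functor C D L + R: cat_functor D C R
  for C :: "('o, 'a) cat" and D :: "('p, 'b) cat" and L R +
  fixes \<eta> :: "'o \<Rightarrow> 'a" and \<epsilon> :: "'p \<Rightarrow> 'b"
  assumes is_adjunction: "is_adjunction C D L R \<eta> \<epsilon>"
begin

abbreviation comp_C (infixr \<open>\<cdot>\<close> 55) where "g \<cdot> f \<equiv> Comp C g f"
abbreviation comp_D (infixr \<open>\<star>\<close> 55) where "g \<star> f \<equiv> Comp D g f"
abbreviation (input) "Lo \<equiv> map_obj L"
abbreviation (input) "Ro \<equiv> map_obj R"
abbreviation (input) "La \<equiv> map_arr L"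
abbreviation (input) "Ra \<equiv> map_arr R"
abbreviation "T \<equiv> monad_of_adjunction L R \<eta> \<epsilon>"
abbreviation "EM \<equiv> eilenberg_moore_functor D R \<epsilon>"

lemma unit_nat: "is_nat_trans C C id_functor (R \<circ>\<^sub>F L) \<eta>"
  and counit_nat: "is_nat_trans D D (L \<circ>\<^sub>F R) id_functor \<epsilon>"
  using is_adjunction by (auto simp: is_adjunction_def)

lemma unit_simps [simp]:
  assumes "X \<in> Obj C"
  shows "\<eta> X \<in> Arr C" "Dom C (\<eta> X) = X" "Cod C (\<eta> X) = Ro (Lo X)"
  using is_nat_transD[OF unit_nat] assms by simp_all

lemma counit_simps [simp]:
  assumes "Z \<in> Obj D"
  shows "\<epsilon> Z \<in> Arr D" "Dom D (\<epsilon> Z) = Lo (Ro Z)" "Cod D (\<epsilon> Z) = Z"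
  using is_nat_transD[OF counit_nat] assms by simp_all

lemma unit_natural:
  "f \<in> Arr C \<Longrightarrow> Dom C f = X \<Longrightarrow> Cod C f = Y \<Longrightarrow> \<eta> Y \<cdot> f = Ra (La f) \<cdot> \<eta> X"
  using is_nat_transD(4)[OF unit_nat] by simp

lemma counit_natural:
  "f \<in> Arr D \<Longrightarrow> Dom D f = X \<Longrightarrow> Cod D f = Y \<Longrightarrow> \<epsilon> Y \<star> La (Ra f) = f \<star> \<epsilon> X"
  using is_nat_transD(4)[OF counit_nat] by simp

lemma triangle_L: "X \<in> Obj C \<Longrightarrow> \<epsilon> (Lo X) \<star> La (\<eta> X) = Ident D (Lo X)"
  and triangle_R: "Z \<in> Obj D \<Longrightarrow> Ra (\<epsilon> Z) \<cdot> \<eta> (Ro Z) = Ident C (Ro Z)"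
  using is_adjunction by (auto simp: is_adjunction_def)

lemma monad_simps [simp]:
  "map_obj (Endo T) X = Ro (Lo X)" "map_arr (Endo T) f = Ra (La f)" "mon_unit T = \<eta>"
  "mon_mult T X = Ra (\<epsilon> (Lo X))"
  by (simp_all add: monad_of_adjunction_def)

text \<open>Associativity of the monad, the module axiom for \<open>R \<epsilon>\<close> and the linearity of \<open>R f\<close> are all
  instances of this one square.\<close>

lemma R_counit_natural:
  assumes "f \<in> Arr D" "Dom D f = X" "Cod D f = Y"
  shows "Ra (\<epsilon> Y) \<cdot> Ra (La (Ra f)) = Ra f \<cdot> Ra (\<epsilon> X)"
proof -
  have "Ra (\<epsilon> Y) \<cdot> Ra (La (Ra f)) = Ra (\<epsilon> Y \<star> La (Ra f))" using assms by auto
  also have "\<dots> = Ra f \<cdot> Ra (\<epsilon> X)" using assms by (auto simp: counit_natural)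
  finally show ?thesis .
qed

theorem is_monad_of_adjunction: "is_monad C T"
proof -
  have Endo: "Endo T = R \<circ>\<^sub>F L" by (simp add: monad_of_adjunction_def)
  have RL: "is_functor C C (R \<circ>\<^sub>F L)"
    by (rule is_functor_comp[OF L.is_functor R.is_functor])
  have "is_nat_trans C C (Endo T \<circ>\<^sub>F Endo T) (Endo T) (mon_mult T)"
    unfolding is_nat_trans_def using RL
    by (auto simp: Endo is_functor_comp Hom_def R_counit_natural)
  moreover have "Ra (\<epsilon> (Lo X)) \<cdot> Ra (La (\<eta> X)) = Ident C (Ro (Lo X))" if "X \<in> Obj C" for X
  proof -
    have "Ra (\<epsilon> (Lo X)) \<cdot> Ra (La (\<eta> X)) = Ra (\<epsilon> (Lo X) \<star> La (\<eta> X))" using that by simp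
    then show ?thesis using that by (simp add: triangle_L)
  qed
  ultimately show ?thesis
    using unit_nat by (auto simp: is_monad_def Endo[symmetric] triangle_R R_counit_natural)
qed

end

lemma adjunctionI: "is_adjunction C D L R \<eta> \<epsilon> \<Longrightarrow> adjunction C D L R \<eta> \<epsilon>"
  by (simp add: adjunction_def adjunction_axioms_def cat_functorI is_adjunction_def)

lemma monad_module_cat_simps [simp]:
  "Obj (monad_module_cat C A) = monad_modules C A"
  "Dom (monad_module_cat C A) (M, f, N) = M"
  "Cod (monad_module_cat C A) (M, f, N) = N"
  "Ident (monad_module_cat C A) M = (M, Ident C (fst M), M)"
  "Comp (monad_module_cat C A) (N', g, P) (M, f, N) = (M, Comp C g f, P)"
  "(M, f, N) \<in> Arr (monad_module_cat C A) \<longleftrightarrow> M \<in> monad_modules C A \<and> N \<in> monad_modules C A \<and>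
     f \<in> Arr C \<and> Dom C f = fst M \<and> Cod C f = fst N \<and>
     Comp C f (snd M) = Comp C (snd N) (map_arr (Endo A) f)"
  by (cases M; cases N; auto simp: monad_module_cat_def Hom_def)+

lemma monad_modules_iff:
  "(X, \<rho>) \<in> monad_modules C A \<longleftrightarrow> X \<in> Obj C \<and> \<rho> \<in> Arr C \<and>
     Dom C \<rho> = map_obj (Endo A) X \<and> Cod C \<rho> = X \<and>
     Comp C \<rho> (map_arr (Endo A) \<rho>) = Comp C \<rho> (mon_mult A X) \<and>
     Comp C \<rho> (mon_unit A X) = Ident C X"
  by (auto simp: monad_modules_def Hom_def)

lemma is_category_monad_module_cat:
  assumes "is_monad C A"
  shows "is_category (monad_module_cat C A)"
proof -
  have "is_functor C C (Endo A)" using assms by (simp add: is_monad_def is_nat_trans_def)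
  then interpret A: cat_functor C C "Endo A" by (rule cat_functorI)
  have square: "Comp C (Comp C g f) \<rho> = Comp C \<tau> (Comp C (map_arr (Endo A) g) (map_arr (Endo A) f))"
    if "Comp C f \<rho> = Comp C \<sigma> (map_arr (Endo A) f)" "Comp C g \<sigma> = Comp C \<tau> (map_arr (Endo A) g)"
      "f \<in> Arr C" "g \<in> Arr C" "Cod C f = Dom C g" "\<rho> \<in> Arr C" "\<sigma> \<in> Arr C" "\<tau> \<in> Arr C"
      "Cod C \<rho> = Dom C f" "Dom C \<sigma> = map_obj (Endo A) (Cod C f)" "Cod C \<sigma> = Cod C f"
      "Dom C \<tau> = map_obj (Endo A) (Cod C g)"
    for f g \<rho> \<sigma> \<tau>
  proof -
    have "Comp C (Comp C g f) \<rho> = Comp C g (Comp C \<sigma> (map_arr (Endo A) f))"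
      using that by (simp add: A.C.assoc)
    also have "\<dots> = Comp C (Comp C \<tau> (map_arr (Endo A) g)) (map_arr (Endo A) f)"
      using that by (simp add: A.C.assoc[symmetric])
    also have "\<dots> = Comp C \<tau> (Comp C (map_arr (Endo A) g) (map_arr (Endo A) f))"
      using that by (simp add: A.C.assoc)
    finally show ?thesis .
  qed
  show ?thesis
    unfolding is_category_def
  proof (intro conjI ballI impI, goal_cases)
    case (4 f g)
    obtain M h N where f: "f = (M, h, N)" by (cases f)
    obtain N' h' P where g: "g = (N', h', P)" by (cases g)
    show ?case
      using 4 square[of h "snd M" "snd N" h' "snd P"]
      by (cases M; cases N; cases P) (auto simp: f g Hom_def monad_modules_iff)
  qed (auto simp: Hom_def monad_modules_iff A.C.assoc)
qed

lemma map_eilenberg_moore_functor [simp]: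
  "map_obj (eilenberg_moore_functor D R \<epsilon>) Z = (map_obj R Z, map_arr R (\<epsilon> Z))"
  "map_arr (eilenberg_moore_functor D R \<epsilon>) f =
    ((map_obj R (Dom D f), map_arr R (\<epsilon> (Dom D f))), map_arr R f,
     (map_obj R (Cod D f), map_arr R (\<epsilon> (Cod D f))))"
  by (simp_all add: eilenberg_moore_functor_def)

context adjunction
begin

lemma is_functor_eilenberg_moore: "is_functor D (monad_module_cat C T) EM"
proof -
  have "(Ro Z, Ra (\<epsilon> Z)) \<in> monad_modules C T" if "Z \<in> Obj D" for Z
    using that by (simp add: monad_modules_iff triangle_R R_counit_natural)
  then show ?thesis
    using is_category_monad_module_cat[OF is_monad_of_adjunction]
    by (auto simp: is_functor_def Hom_def L.D.is_category R_counit_natural)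
qed

lemma eilenberg_moore_comp_left: "functor_eq C (EM \<circ>\<^sub>F L) (extension_functor C T)"
  by (simp add: functor_eq_def extension_functor_def)

lemma forgetful_comp_eilenberg_moore: "functor_eq D (forgetful_functor \<circ>\<^sub>F EM) R"
  by (simp add: functor_eq_def forgetful_functor_def)

end

section \<open>Monadicity of adjunctions with a split counit\<close>

text \<open>Besides full faithfulness, the point is that a module \<open>(X, \<rho>)\<close> is in the essential image. The
  composite \<open>e = L \<rho> \<circ> \<sigma>\<close> on \<open>L X\<close> satisfies \<open>e \<circ> L \<rho> = e \<circ> \<epsilon>\<close>, by naturality of \<open>\<sigma>\<close> and associativity
  of \<open>\<rho>\<close>. Hence \<open>e\<close> is idempotent, and if \<open>p : L X \<rightarrow> Z\<close> and \<open>i : Z \<rightarrow> L X\<close> split it, the transpose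
  \<open>R p \<circ> \<eta>\<close> of \<open>p\<close> is an isomorphism of modules from \<open>(X, \<rho>)\<close> to \<open>(R Z, R \<epsilon>)\<close>, with inverse
  \<open>\<rho> \<circ> R i\<close>.\<close>

theorem (in adjunction) eilenberg_moore_equivalence_if_counit_splits:
  assumes sec: "is_nat_trans D D id_functor (L \<circ>\<^sub>F R) \<sigma>"
    and split: "\<And>Z. Z \<in> Obj D \<Longrightarrow> \<epsilon> Z \<star> \<sigma> Z = Ident D Z"
    and idem: "\<And>e. e \<in> Arr D \<Longrightarrow> Cod D e = Dom D e \<Longrightarrow> e \<star> e = e \<Longrightarrow>
      \<exists>Z\<in>Obj D. \<exists>p\<in>Hom D (Dom D e) Z. \<exists>i\<in>Hom D Z (Dom D e).
        p \<star> i = Ident D Z \<and> i \<star> p = e"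
  shows "is_equivalence D (monad_module_cat C T) EM"
proof -
  interpret EM: cat_functor D "monad_module_cat C T" EM
    by (rule cat_functorI) (rule is_functor_eilenberg_moore)
  have sec_simps [simp]: "\<sigma> Z \<in> Arr D" "Dom D (\<sigma> Z) = Z" "Cod D (\<sigma> Z) = Lo (Ro Z)"
    if "Z \<in> Obj D" for Z
    using is_nat_transD[OF sec] that by simp_all
  have sec_natural: "\<sigma> Y \<star> f = La (Ra f) \<star> \<sigma> X" if "f \<in> Arr D" "Dom D f = X" "Cod D f = Y" for f X Y
    using is_nat_transD(4)[OF sec] that by simp
  have R_split: "Ra (\<epsilon> Z) \<cdot> Ra (\<sigma> Z) = Ident C (Ro Z)" if "Z \<in> Obj D" for Z
    using R.map_comp[of "\<sigma> Z" "\<epsilon> Z"] split[OF that] that by simp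
  show ?thesis
  proof (rule EM.equivalence_if_fully_faithful_ess_surj)
    have recover: "\<epsilon> (Cod D f) \<star> La (Ra f) \<star> \<sigma> (Dom D f) = f" if f: "f \<in> Arr D" for f
    proof -
      have "\<epsilon> (Cod D f) \<star> La (Ra f) \<star> \<sigma> (Dom D f) = (f \<star> \<epsilon> (Dom D f)) \<star> \<sigma> (Dom D f)"
        using f by (simp add: L.D.comp_left_cong counit_natural)
      then show ?thesis using f by (simp add: L.D.assoc split)
    qed
    fix f g assume fg: "f \<in> Arr D" "g \<in> Arr D" "Dom D f = Dom D g" "Cod D f = Cod D g"
      "map_arr EM f = map_arr EM g"
    then have "Ra f = Ra g" by simp
    then show "f = g" using recover[OF fg(1)] recover[OF fg(2)] fg(3,4) by argo
  next
    fix X Y g assume X: "X \<in> Obj D" and Y: "Y \<in> Obj D"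
      and "g \<in> Hom (monad_module_cat C T) (map_obj EM X) (map_obj EM Y)"
    then obtain h where g: "g = (map_obj EM X, h, map_obj EM Y)"
      and h [simp]: "h \<in> Arr C" "Dom C h = Ro X" "Cod C h = Ro Y"
      and lin: "h \<cdot> Ra (\<epsilon> X) = Ra (\<epsilon> Y) \<cdot> Ra (La h)"
      by (cases g) (auto simp: Hom_def)
    \<comment> \<open>The formula of \<open>recover\<close> with \<open>h\<close> in place of \<open>Ra f\<close>; linearity of \<open>h\<close> moves \<open>h\<close> past the
      counit, which then cancels against the section.\<close>
    define f where "f = \<epsilon> Y \<star> La h \<star> \<sigma> X"
    have f: "f \<in> Hom D X Y" using X Y by (simp add: f_def Hom_def)
    have "Ra f = (Ra (\<epsilon> Y) \<cdot> Ra (La h)) \<cdot> Ra (\<sigma> X)"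
      using X Y by (simp add: f_def L.C.assoc)
    also have "\<dots> = h" using X Y by (simp add: lin[symmetric] L.C.assoc R_split)
    finally have "map_arr EM f = g" using HomD[OF f] by (simp add: g)
    with f show "\<exists>f\<in>Hom D X Y. map_arr EM f = g" by blast
  next
    fix M assume "M \<in> Obj (monad_module_cat C T)"
    then obtain X \<rho> where M: "M = (X, \<rho>)" "(X, \<rho>) \<in> monad_modules C T" by (cases M) simp
    then have X [simp]: "X \<in> Obj C"
      and \<rho> [simp]: "\<rho> \<in> Arr C" "Dom C \<rho> = Ro (Lo X)" "Cod C \<rho> = X"
      and act_assoc: "\<rho> \<cdot> Ra (La \<rho>) = \<rho> \<cdot> Ra (\<epsilon> (Lo X))"
      and act_unit: "\<rho> \<cdot> \<eta> X = Ident C X"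
      by (simp_all add: monad_modules_iff)
    have L_act_assoc: "La \<rho> \<star> La (Ra (La \<rho>)) = La \<rho> \<star> La (Ra (\<epsilon> (Lo X)))"
      using L.map_comp[of "Ra (La \<rho>)" \<rho>] L.map_comp[of "Ra (\<epsilon> (Lo X))" \<rho>] act_assoc by simp
    define e where "e = La \<rho> \<star> \<sigma> (Lo X)"
    have e [simp]: "e \<in> Arr D" "Dom D e = Lo X" "Cod D e = Lo X" by (simp_all add: e_def)
    \<comment> \<open>The right hand side is \<open>e \<star> \<epsilon> (Lo X)\<close> written out: after composing with \<open>e\<close>, the action
      and the counit agree.\<close>
    have e_act: "e \<star> La \<rho> = La \<rho> \<star> \<sigma> (Lo X) \<star> \<epsilon> (Lo X)"
    proof -
      have "e \<star> La \<rho> = La \<rho> \<star> La (Ra (La \<rho>)) \<star> \<sigma> (Lo (Ro (Lo X)))"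
        by (simp add: e_def L.D.assoc sec_natural)
      also have "\<dots> = (La \<rho> \<star> La (Ra (\<epsilon> (Lo X)))) \<star> \<sigma> (Lo (Ro (Lo X)))"
        by (rule L.D.comp_left_cong[OF L_act_assoc]) simp_all
      also have "\<dots> = La \<rho> \<star> \<sigma> (Lo X) \<star> \<epsilon> (Lo X)"
        by (simp add: L.D.assoc sec_natural)
      finally show ?thesis .
    qed
    have "e \<star> e = (e \<star> La \<rho>) \<star> \<sigma> (Lo X)" by (simp add: e_def L.D.assoc)
    also have "\<dots> = e" by (simp add: e_act) (simp add: L.D.assoc split e_def)
    finally have "e \<star> e = e" .
    from idem[OF _ _ this] obtain Z p i where Z [simp]: "Z \<in> Obj D"
      and p [simp]: "p \<in> Arr D" "Dom D p = Lo X" "Cod D p = Z"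
      and i [simp]: "i \<in> Arr D" "Dom D i = Z" "Cod D i = Lo X"
      and pi: "p \<star> i = Ident D Z" and ip: "i \<star> p = e"
      by (auto simp: Hom_def)
    have pe: "p \<star> e = p"
      using L.D.comp_left_cong[OF pi, of p] by (simp add: ip[symmetric])
    have p_act: "p \<star> La \<rho> = p \<star> \<epsilon> (Lo X)"
    proof -
      have "p \<star> La \<rho> = (p \<star> e) \<star> La \<rho>" by (simp add: pe)
      also have "\<dots> = p \<star> (La \<rho> \<star> \<sigma> (Lo X) \<star> \<epsilon> (Lo X))" by (simp add: L.D.assoc e_act)
      also have "\<dots> = (p \<star> e) \<star> \<epsilon> (Lo X)" by (simp add: e_def L.D.assoc)
      finally show ?thesis by (simp add: pe)
    qed
    define \<phi> where "\<phi> = Ra p \<cdot> \<eta> X"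
    define \<psi> where "\<psi> = \<rho> \<cdot> Ra i"
    have \<phi> [simp]: "\<phi> \<in> Arr C" "Dom C \<phi> = X" "Cod C \<phi> = Ro Z" by (simp_all add: \<phi>_def)
    have \<psi> [simp]: "\<psi> \<in> Arr C" "Dom C \<psi> = Ro Z" "Cod C \<psi> = X" by (simp_all add: \<psi>_def)
    \<comment> \<open>This identity gives both \<open>\<phi> \<cdot> \<psi> = 1\<close> and the linearity of \<open>\<phi>\<close>.\<close>
    have \<phi>_act: "\<phi> \<cdot> \<rho> = Ra p"
    proof -
      have "\<phi> \<cdot> \<rho> = Ra p \<cdot> Ra (La \<rho>) \<cdot> \<eta> (Ro (Lo X))"
        by (simp add: \<phi>_def L.C.assoc unit_natural)
      also have "\<dots> = Ra (p \<star> La \<rho>) \<cdot> \<eta> (Ro (Lo X))" by (simp add: L.C.assoc)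
      also have "\<dots> = Ra p" by (simp add: p_act L.C.assoc triangle_R)
      finally show ?thesis .
    qed
    have "\<phi> \<cdot> \<psi> = (\<phi> \<cdot> \<rho>) \<cdot> Ra i" unfolding \<psi>_def by (rule L.C.assoc[symmetric]) simp_all
    also have "\<dots> = Ra (p \<star> i)" by (simp add: \<phi>_act)
    finally have \<phi>\<psi>: "\<phi> \<cdot> \<psi> = Ident C (Ro Z)" by (simp add: pi)
    have "\<psi> \<cdot> \<phi> = \<rho> \<cdot> Ra (i \<star> p) \<cdot> \<eta> X" by (simp add: \<psi>_def \<phi>_def L.C.assoc)
    also have "\<dots> = (\<rho> \<cdot> Ra (La \<rho>)) \<cdot> Ra (\<sigma> (Lo X)) \<cdot> \<eta> X"
      by (simp add: ip) (simp add: e_def L.C.assoc)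
    also have "\<dots> = \<rho> \<cdot> (Ra (\<epsilon> (Lo X)) \<cdot> Ra (\<sigma> (Lo X))) \<cdot> \<eta> X"
      by (simp add: act_assoc) (simp add: L.C.assoc)
    also have "\<dots> = Ident C X" by (simp add: R_split act_unit)
    finally have \<psi>\<phi>: "\<psi> \<cdot> \<phi> = Ident C X" .
    have "\<psi> \<cdot> Ra (\<epsilon> Z) = \<rho> \<cdot> Ra (\<epsilon> (Lo X)) \<cdot> Ra (La (Ra i))"
      by (simp add: \<psi>_def L.C.assoc R_counit_natural)
    also have "\<dots> = (\<rho> \<cdot> Ra (La \<rho>)) \<cdot> Ra (La (Ra i))"
      by (simp add: act_assoc) (simp add: L.C.assoc)
    also have "\<dots> = \<rho> \<cdot> Ra (La \<psi>)" by (simp add: \<psi>_def L.C.assoc)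
    finally have \<psi>_lin: "\<psi> \<cdot> Ra (\<epsilon> Z) = \<rho> \<cdot> Ra (La \<psi>)" .
    have "\<phi> \<cdot> \<rho> = (Ra p \<cdot> Ra (\<epsilon> (Lo X))) \<cdot> Ra (La (\<eta> X))"
    proof -
      have "Ra (\<epsilon> (Lo X)) \<cdot> Ra (La (\<eta> X)) = Ident C (Ro (Lo X))"
        using R.map_comp[of "La (\<eta> X)" "\<epsilon> (Lo X)"] by (simp add: triangle_L)
      then show ?thesis by (simp add: L.C.assoc \<phi>_act)
    qed
    also have "\<dots> = (Ra (\<epsilon> Z) \<cdot> Ra (La (Ra p))) \<cdot> Ra (La (\<eta> X))"
      by (simp add: R_counit_natural)
    also have "\<dots> = Ra (\<epsilon> Z) \<cdot> Ra (La \<phi>)" by (simp add: \<phi>_def L.C.assoc)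
    finally have \<phi>_lin: "\<phi> \<cdot> \<rho> = Ra (\<epsilon> Z) \<cdot> Ra (La \<phi>)" .
    have EZ: "map_obj EM Z \<in> monad_modules C T" using EM.map_obj_obj[of Z] by simp
    have "(map_obj EM Z, \<psi>, M) \<in> Hom (monad_module_cat C T) (map_obj EM Z) M"
      using M EZ by (simp add: Hom_def \<psi>_lin)
    moreover have "is_iso (monad_module_cat C T) (map_obj EM Z, \<psi>, M)"
      by (rule EM.D.is_isoI[where g = "(M, \<phi>, map_obj EM Z)"])
        (use M EZ in \<open>simp_all add: \<psi>_lin \<phi>_lin \<phi>\<psi> \<psi>\<phi>\<close>)
    ultimately show "\<exists>Z\<in>Obj D. \<exists>b\<in>Hom (monad_module_cat C T) (map_obj EM Z) M.
        is_iso (monad_module_cat C T) b"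
      using Z by blast
  qed
qed


section \<open>Categories of left modules\<close>

lemma left_moduleI:
  assumes "ring R" "abelian_group M"
    and "\<And>a x. \<lbrakk>a \<in> carrier R; x \<in> carrier M\<rbrakk> \<Longrightarrow> a \<odot>\<^bsub>M\<^esub> x \<in> carrier M"
    and "\<And>a b x. \<lbrakk>a \<in> carrier R; b \<in> carrier R; x \<in> carrier M\<rbrakk> \<Longrightarrow>
      (a \<oplus>\<^bsub>R\<^esub> b) \<odot>\<^bsub>M\<^esub> x = a \<odot>\<^bsub>M\<^esub> x \<oplus>\<^bsub>M\<^esub> b \<odot>\<^bsub>M\<^esub> x"
    and "\<And>a x y. \<lbrakk>a \<in> carrier R; x \<in> carrier M; y \<in> carrier M\<rbrakk> \<Longrightarrow>
      a \<odot>\<^bsub>M\<^esub> (x \<oplus>\<^bsub>M\<^esub> y) = a \<odot>\<^bsub>M\<^esub> x \<oplus>\<^bsub>M\<^esub> a \<odot>\<^bsub>M\<^esub> y"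
    and "\<And>a b x. \<lbrakk>a \<in> carrier R; b \<in> carrier R; x \<in> carrier M\<rbrakk> \<Longrightarrow>
      (a \<otimes>\<^bsub>R\<^esub> b) \<odot>\<^bsub>M\<^esub> x = a \<odot>\<^bsub>M\<^esub> (b \<odot>\<^bsub>M\<^esub> x)"
    and "\<And>x. x \<in> carrier M \<Longrightarrow> \<one>\<^bsub>R\<^esub> \<odot>\<^bsub>M\<^esub> x = x"
  shows "left_module R M"
  using assms by (auto intro!: left_module.intro left_module_axioms.intro)

lemma left_module_imp:
  assumes "left_module R M"
  shows "ring R" "abelian_group M"
  using assms by (simp_all add: left_module_def)

lemma lmod_homI:
  assumes "\<And>x. x \<in> carrier M \<Longrightarrow> f x \<in> carrier N"
    and "\<And>x y. x \<in> carrier M \<Longrightarrow> y \<in> carrier M \<Longrightarrow> f (x \<oplus>\<^bsub>M\<^esub> y) = f x \<oplus>\<^bsub>N\<^esub> f y"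
    and "\<And>a x. a \<in> carrier R \<Longrightarrow> x \<in> carrier M \<Longrightarrow> f (a \<odot>\<^bsub>M\<^esub> x) = a \<odot>\<^bsub>N\<^esub> f x"
    and "f \<in> extensional (carrier M)"
  shows "f \<in> lmod_hom R M N"
  using assms by (auto simp: lmod_hom_def PiE_def)

lemma lmod_homD:
  assumes "f \<in> lmod_hom R M N"
  shows "x \<in> carrier M \<Longrightarrow> f x \<in> carrier N"
    and "x \<in> carrier M \<Longrightarrow> y \<in> carrier M \<Longrightarrow> f (x \<oplus>\<^bsub>M\<^esub> y) = f x \<oplus>\<^bsub>N\<^esub> f y"
    and "a \<in> carrier R \<Longrightarrow> x \<in> carrier M \<Longrightarrow> f (a \<odot>\<^bsub>M\<^esub> x) = a \<odot>\<^bsub>N\<^esub> f x"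
    and "f \<in> extensional (carrier M)"
  using assms by (auto simp: lmod_hom_def PiE_def)

lemma lmod_hom_zero:
  assumes "left_module R M" "left_module R N" "f \<in> lmod_hom R M N"
  shows "f \<zero>\<^bsub>M\<^esub> = \<zero>\<^bsub>N\<^esub>"
proof -
  interpret M: left_module R M by fact
  interpret N: left_module R N by fact
  have "f \<zero>\<^bsub>M\<^esub> \<oplus>\<^bsub>N\<^esub> f \<zero>\<^bsub>M\<^esub> = f \<zero>\<^bsub>M\<^esub>"
    using lmod_homD(2)[OF assms(3), of "\<zero>\<^bsub>M\<^esub>" "\<zero>\<^bsub>M\<^esub>"] by simp
  then show ?thesis
    using lmod_homD(1)[OF assms(3)] by simp
qed

lemma module_cat_simps [simp]:
  "M \<in> Obj (module_cat R) \<longleftrightarrow> left_module R M"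
  "(M, f, N) \<in> Arr (module_cat R) \<longleftrightarrow> left_module R M \<and> left_module R N \<and> f \<in> lmod_hom R M N"
  "Dom (module_cat R) (M, f, N) = M"
  "Cod (module_cat R) (M, f, N) = N"
  "Ident (module_cat R) M = (M, \<lambda>x\<in>carrier M. x, M)"
  "Comp (module_cat R) (N', g, P) (M, f, N) = (M, compose (carrier M) g f, P)"
  by (simp_all add: module_cat_def)

lemma lmod_hom_compose:
  assumes "f \<in> lmod_hom R M N" "g \<in> lmod_hom R N P" "left_module R M"
  shows "compose (carrier M) g f \<in> lmod_hom R M P"
proof -
  interpret M: left_module R M by fact
  show ?thesis
    by (rule lmod_homI)
      (use lmod_homD[OF assms(1)] lmod_homD[OF assms(2)] M.smult_closed
        in \<open>auto simp: compose_eq\<close>)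
qed

lemma lmod_hom_ident: "left_module R M \<Longrightarrow> (\<lambda>x\<in>carrier M. x) \<in> lmod_hom R M M"
  by (rule lmod_homI) (auto simp: left_module.smult_closed left_module_imp abelian_group.axioms(1)
      abelian_monoid.a_closed)

lemma is_category_module_cat: "is_category (module_cat R)"
proof -
  have "compose (carrier M) f (\<lambda>x\<in>carrier M. x) = f"
    "compose (carrier M) (\<lambda>x\<in>carrier N. x) f = f"
    if "f \<in> lmod_hom R M N" for f M N
    using lmod_homD[OF that] by (auto simp: fun_eq_iff compose_def extensional_def)
  moreover have "compose (carrier M) h (compose (carrier M) g f) =
      compose (carrier M) (compose (carrier N) h g) f"
    if "f \<in> lmod_hom R M N" for f g h M N
    using lmod_homD[OF that] by (auto simp: compose_def restrict_def)
  ultimately show ?thesis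
    unfolding is_category_def by (auto simp: Hom_def lmod_hom_compose lmod_hom_ident)
qed

lemma left_module_image:
  assumes M: "left_module R M" and N: "left_module R N" and f: "f \<in> lmod_hom R M N"
  shows "left_module R (N\<lparr>carrier := f ` carrier M\<rparr>)"
proof -
  interpret M: left_module R M by fact
  interpret N: left_module R N by fact
  note [simp] = lmod_homD(1)[OF f] lmod_homD(2,3)[OF f, symmetric] M.smult_closed
  have f0: "f \<zero>\<^bsub>M\<^esub> = \<zero>\<^bsub>N\<^esub>" by (rule lmod_hom_zero[OF M N f])
  show ?thesis
  proof (rule left_moduleI, rule M.ring_axioms, rule abelian_groupI, goal_cases)
    case 2
    show ?case using f0 by (auto intro!: image_eqI[of _ _ "\<zero>\<^bsub>M\<^esub>"])
  next
    case (6 x)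
    then obtain y where y: "x = f y" "y \<in> carrier M" by auto
    then have "f (\<ominus>\<^bsub>M\<^esub> y) \<oplus>\<^bsub>N\<^esub> x = \<zero>\<^bsub>N\<^esub>" by (simp add: M.l_neg f0)
    with y show ?case by auto
  next
    case (3 x y z)
    then show ?case by (auto simp: M.a_assoc)
  next
    case (4 x y)
    then show ?case by (auto simp: M.a_comm)
  next
    case (5 x)
    then show ?case by (auto simp del: lmod_homD(2,3)[OF f, symmetric])
  qed (auto simp: M.smult_l_distr M.smult_r_distr M.smult_assoc M.smult_one)
qed

text \<open>An idempotent endomorphism restricts to the identity on its image, so it splits as the
  corestriction to the image followed by the inclusion.\<close>

lemma idempotents_split_module_cat:
  assumes "e \<in> Arr (module_cat R)" "Cod (module_cat R) e = Dom (module_cat R) e"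
    and "Comp (module_cat R) e e = e"
  shows "\<exists>Z\<in>Obj (module_cat R). \<exists>p\<in>Hom (module_cat R) (Dom (module_cat R) e) Z.
    \<exists>i\<in>Hom (module_cat R) Z (Dom (module_cat R) e).
      Comp (module_cat R) p i = Ident (module_cat R) Z \<and> Comp (module_cat R) i p = e"
proof -
  obtain M f where e: "e = (M, f, M)" and M: "left_module R M" and f: "f \<in> lmod_hom R M M"
    using assms(1,2) by (cases e) auto
  note fD = lmod_homD[OF f]
  have idem: "f (f x) = f x" if "x \<in> carrier M" for x
    using assms(3) that by (auto simp: e compose_def restrict_def fun_eq_iff split: if_splits)
  define Z where "Z = M\<lparr>carrier := f ` carrier M\<rparr>"
  have Z: "left_module R Z" unfolding Z_def by (rule left_module_image[OF M M f])
  have p: "f \<in> lmod_hom R M Z"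
    by (rule lmod_homI) (use fD in \<open>auto simp: Z_def\<close>)
  have i: "(\<lambda>x\<in>carrier Z. x) \<in> lmod_hom R Z M"
    by (rule lmod_homI)
      (use lmod_homD[OF lmod_hom_ident[OF Z]] fD(1) in \<open>auto simp: Z_def\<close>)
  show ?thesis
  proof (intro bexI conjI)
    show "Comp (module_cat R) (M, f, Z) (Z, \<lambda>x\<in>carrier Z. x, M) = Ident (module_cat R) Z"
      by (auto simp: compose_def fun_eq_iff Z_def idem)
    show "Comp (module_cat R) (Z, \<lambda>x\<in>carrier Z. x, M) (M, f, Z) = e"
      using fD(4) by (auto simp: compose_def fun_eq_iff Z_def e extensional_def)
  qed (use M Z p i in \<open>auto simp: e Hom_def\<close>)
qed

lemma left_module_transport:
  assumes "left_module R M" "inj enc"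
  shows "left_module R (transport_module enc M)"
proof -
  interpret M: left_module R M by fact
  note [simp] = inv_into_f_f[OF \<open>inj enc\<close>] M.smult_closed
  show ?thesis
  proof (rule left_moduleI, rule M.ring_axioms, rule abelian_groupI, goal_cases)
    case (6 x)
    then obtain y where "x = enc y" "y \<in> carrier M" by (auto simp: transport_module_def)
    then show ?case
      by (auto simp: transport_module_def M.l_neg intro!: bexI[of _ "\<ominus>\<^bsub>M\<^esub> y"])
  qed (auto simp: transport_module_def M.a_ac M.smult_l_distr M.smult_r_distr
      M.smult_assoc M.smult_one)
qed


section \<open>Restriction and coinduction along a ring extension\<close>

definition restriction_functor ::
  "('r, 'n) ring_scheme \<Rightarrow>
    (('r, 'u) module, ('r, 'u) mod_arr, ('r, 'u) module, ('r, 'u) mod_arr) cfunctor" where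
  "restriction_functor S =
     \<lparr>map_obj = res_module S, map_arr = (\<lambda>(V, f, V'). (res_module S V, f, res_module S V'))\<rparr>"

lemma restriction_functor_simps [simp]:
  "map_obj (restriction_functor S) V = res_module S V"
  "map_arr (restriction_functor S) (V, f, V') = (res_module S V, f, res_module S V')"
  by (simp_all add: restriction_functor_def)

definition coinduction_functor ::
  "('r, 'm) ring_scheme \<Rightarrow> ('r, 'n) ring_scheme \<Rightarrow> (('r \<Rightarrow> 'u) \<Rightarrow> 'u) \<Rightarrow>
    (('r, 'u) module, ('r, 'u) mod_arr, ('r, 'u) module, ('r, 'u) mod_arr) cfunctor" where
  "coinduction_functor R S enc =
     \<lparr>map_obj = coind_module R S enc,
      map_arr = (\<lambda>(W, f, W'). (coind_module R S enc W,
        \<lambda>u\<in>carrier (coind_module R S enc W). enc (\<lambda>x\<in>carrier R. f (inv_into UNIV enc u x)),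
        coind_module R S enc W'))\<rparr>"

definition coinduction_unit ::
  "('r, 'm) ring_scheme \<Rightarrow> ('r, 'n) ring_scheme \<Rightarrow> (('r \<Rightarrow> 'u) \<Rightarrow> 'u) \<Rightarrow>
    ('r, 'u) module \<Rightarrow> ('r, 'u) mod_arr" where
  "coinduction_unit R S enc V =
     (V, \<lambda>v\<in>carrier V. enc (\<lambda>x\<in>carrier R. x \<odot>\<^bsub>V\<^esub> v), coind_module R S enc (res_module S V))"

definition coinduction_counit ::
  "('r, 'm) ring_scheme \<Rightarrow> ('r, 'n) ring_scheme \<Rightarrow> (('r \<Rightarrow> 'u) \<Rightarrow> 'u) \<Rightarrow>
    ('r, 'u) module \<Rightarrow> ('r, 'u) mod_arr" where
  "coinduction_counit R S enc W =
     (res_module S (coind_module R S enc W),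
      \<lambda>u\<in>carrier (coind_module R S enc W). inv_into UNIV enc u \<one>\<^bsub>R\<^esub>, W)"

text \<open>The operations of \<open>S\<close> are only required to agree with those of \<open>R\<close> on the carrier of \<open>S\<close>: the
  convolution product of a group algebra depends on the group, hence the product of the algebra of a
  subgroup is another function than the product of the whole algebra.\<close>

locale ring_extension = R: ring R + S: ring S
  for R :: "('r, 'm) ring_scheme" and S :: "('r, 'n) ring_scheme" +
  fixes enc :: "('r \<Rightarrow> 'u) \<Rightarrow> 'u"
  assumes subset: "carrier S \<subseteq> carrier R"
    and add_eq: "a \<in> carrier S \<Longrightarrow> b \<in> carrier S \<Longrightarrow> a \<oplus>\<^bsub>S\<^esub> b = a \<oplus>\<^bsub>R\<^esub> b"
    and mult_eq: "a \<in> carrier S \<Longrightarrow> b \<in> carrier S \<Longrightarrow> a \<otimes>\<^bsub>S\<^esub> b = a \<otimes>\<^bsub>R\<^esub> b"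
    and one_eq: "\<one>\<^bsub>S\<^esub> = \<one>\<^bsub>R\<^esub>"
    and inj_enc: "inj enc"
begin

abbreviation "dec \<equiv> inv_into UNIV enc"
abbreviation "coind \<equiv> coind_module R S enc"
abbreviation "res \<equiv> res_module S"
abbreviation "linear_maps W \<equiv> lmod_hom S (res (regular_module R)) W"

lemma dec_enc [simp]: "dec (enc f) = f"
  by (rule inv_into_f_f) (simp_all add: inj_enc)

lemma enc_eq [simp]: "enc f = enc g \<longleftrightarrow> f = g"
  using inj_enc by (auto dest: injD)

lemma subset' [simp]: "a \<in> carrier S \<Longrightarrow> a \<in> carrier R"
  using subset by blast

lemma subring_closed [simp]:
  "a \<in> carrier S \<Longrightarrow> b \<in> carrier S \<Longrightarrow> a \<oplus>\<^bsub>R\<^esub> b \<in> carrier S"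
  "a \<in> carrier S \<Longrightarrow> b \<in> carrier S \<Longrightarrow> a \<otimes>\<^bsub>R\<^esub> b \<in> carrier S"
  "\<one>\<^bsub>R\<^esub> \<in> carrier S"
  using S.a_closed[of a b] S.m_closed[of a b] S.one_closed by (simp_all add: add_eq mult_eq one_eq)

lemma linear_mapsI:
  assumes "\<And>x. x \<in> carrier R \<Longrightarrow> f x \<in> carrier W"
    and "\<And>x y. x \<in> carrier R \<Longrightarrow> y \<in> carrier R \<Longrightarrow> f (x \<oplus>\<^bsub>R\<^esub> y) = f x \<oplus>\<^bsub>W\<^esub> f y"
    and "\<And>s x. s \<in> carrier S \<Longrightarrow> x \<in> carrier R \<Longrightarrow> f (s \<otimes>\<^bsub>R\<^esub> x) = s \<odot>\<^bsub>W\<^esub> f x"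
  shows "(\<lambda>x\<in>carrier R. f x) \<in> linear_maps W"
  using assms by (intro lmod_homI) (auto simp: res_module_def regular_module_def)

lemma linear_mapsD:
  assumes "f \<in> linear_maps W"
  shows "x \<in> carrier R \<Longrightarrow> f x \<in> carrier W"
    and "x \<in> carrier R \<Longrightarrow> y \<in> carrier R \<Longrightarrow> f (x \<oplus>\<^bsub>R\<^esub> y) = f x \<oplus>\<^bsub>W\<^esub> f y"
    and "s \<in> carrier S \<Longrightarrow> x \<in> carrier R \<Longrightarrow> f (s \<otimes>\<^bsub>R\<^esub> x) = s \<odot>\<^bsub>W\<^esub> f x"
    and "f \<in> extensional (carrier R)"
  using lmod_homD[OF assms] by (auto simp: res_module_def regular_module_def)

lemma linear_maps_restrict [simp]: "f \<in> linear_maps W \<Longrightarrow> (\<lambda>x\<in>carrier R. f x) = f"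
  using linear_mapsD(4) by (rule extensional_restrict)

lemma res_simps [simp]:
  "carrier (res V) = carrier V" "add (res V) = add V" "zero (res V) = zero V"
  "s \<in> carrier S \<Longrightarrow> s \<odot>\<^bsub>res V\<^esub> v = s \<odot>\<^bsub>V\<^esub> v"
  by (simp_all add: res_module_def)

lemma carrier_coind: "carrier (coind W) = enc ` linear_maps W"
  by (simp add: coind_module_def transport_module_def hom_module_def)

lemma carrier_coindE:
  assumes "u \<in> carrier (coind W)"
  obtains f where "u = enc f" "f \<in> linear_maps W"
  using assms by (auto simp: carrier_coind)

lemma coind_simps [simp]:
  "enc f \<in> carrier (coind W) \<longleftrightarrow> f \<in> linear_maps W"
  "enc f \<oplus>\<^bsub>coind W\<^esub> enc g = enc (\<lambda>x\<in>carrier R. f x \<oplus>\<^bsub>W\<^esub> g x)"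
  "a \<odot>\<^bsub>coind W\<^esub> enc f = enc (\<lambda>x\<in>carrier R. f (x \<otimes>\<^bsub>R\<^esub> a))"
  by (auto simp: coind_module_def transport_module_def hom_module_def)

lemma left_module_res:
  assumes "left_module R V"
  shows "left_module S (res V)"
proof -
  interpret V: left_module R V by fact
  show ?thesis
  proof (rule left_moduleI, rule S.ring_axioms, rule abelian_groupI, goal_cases)
    case (6 x)
    then show ?case by (auto simp: V.l_neg intro!: bexI[of _ "\<ominus>\<^bsub>V\<^esub> x"])
  qed (auto simp: V.a_ac V.smult_closed V.smult_l_distr V.smult_r_distr V.smult_one V.smult_assoc
      add_eq mult_eq one_eq)
qed

lemma left_module_hom_module:
  assumes "left_module S W"
  shows "left_module R (hom_module R S W)"
proof -
  interpret W: left_module S W by fact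
  note D = linear_mapsD
  have W0: "s \<odot>\<^bsub>W\<^esub> \<zero>\<^bsub>W\<^esub> = \<zero>\<^bsub>W\<^esub>" if "s \<in> carrier S" for s
    using W.smult_r_distr[OF that W.zero_closed W.zero_closed]
      W.smult_closed[OF that W.zero_closed] by simp
  have zero: "(\<lambda>x\<in>carrier R. \<zero>\<^bsub>W\<^esub>) \<in> linear_maps W"
    by (rule linear_mapsI) (simp_all add: W0)
  have add: "(\<lambda>x\<in>carrier R. f x \<oplus>\<^bsub>W\<^esub> g x) \<in> linear_maps W"
    if "f \<in> linear_maps W" "g \<in> linear_maps W" for f g
    by (rule linear_mapsI)
      (use D[OF that(1)] D[OF that(2)] in \<open>simp_all add: W.smult_r_distr W.a_ac\<close>)
  have act: "(\<lambda>x\<in>carrier R. f (x \<otimes>\<^bsub>R\<^esub> a)) \<in> linear_maps W"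
    if "f \<in> linear_maps W" "a \<in> carrier R" for f a
    by (rule linear_mapsI)
      (use D[OF that(1)] that(2) in \<open>simp_all add: R.l_distr R.m_assoc\<close>)
  have neg: "(\<lambda>x\<in>carrier R. \<ominus>\<^bsub>W\<^esub> f x) \<in> linear_maps W" if f: "f \<in> linear_maps W" for f
  proof (rule linear_mapsI)
    fix s x assume s: "s \<in> carrier S" and x: "x \<in> carrier R"
    note [simp] = D(1)[OF f x] W.smult_closed[OF s]
    have "s \<odot>\<^bsub>W\<^esub> (\<ominus>\<^bsub>W\<^esub> f x) \<oplus>\<^bsub>W\<^esub> s \<odot>\<^bsub>W\<^esub> f x = \<zero>\<^bsub>W\<^esub>"
      using W.smult_r_distr[OF s, of "\<ominus>\<^bsub>W\<^esub> f x" "f x"] by (simp add: W.l_neg W0 s)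
    then show "\<ominus>\<^bsub>W\<^esub> f (s \<otimes>\<^bsub>R\<^esub> x) = s \<odot>\<^bsub>W\<^esub> (\<ominus>\<^bsub>W\<^esub> f x)"
      using D(3)[OF f s x] by (simp add: W.minus_equality)
  qed (use D[OF f] in \<open>simp_all add: W.minus_add W.a_comm\<close>)
  show ?thesis
  proof (rule left_moduleI, rule R.ring_axioms, rule abelian_groupI, goal_cases)
    case (5 f)
    then show ?case
      by (auto simp: hom_module_def D fun_eq_iff restrict_def extensional_arb[OF D(4)])
  next
    case (6 f)
    then have f: "f \<in> linear_maps W" by (simp add: hom_module_def)
    show ?case
      by (rule bexI[of _ "\<lambda>x\<in>carrier R. \<ominus>\<^bsub>W\<^esub> f x"])
        (use neg[OF f] in \<open>auto simp: hom_module_def fun_eq_iff restrict_def D[OF f] W.l_neg\<close>)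
  next
    case (11 f)
    then show ?case
      by (auto simp: hom_module_def fun_eq_iff restrict_def extensional_arb[OF D(4)])
  qed (auto simp: hom_module_def zero add act D W.a_ac R.r_distr R.m_assoc
      intro!: restrict_ext)
qed

lemma left_module_coind: "left_module S W \<Longrightarrow> left_module R (coind W)"
  by (simp add: coind_module_def left_module_transport left_module_hom_module inj_enc)

lemma lmod_hom_res:
  assumes "f \<in> lmod_hom R V V'"
  shows "f \<in> lmod_hom S (res V) (res V')"
  by (rule lmod_homI) (use lmod_homD[OF assms] in simp_all)

lemma linear_maps_postcompose:
  assumes "f \<in> lmod_hom S W W'" "h \<in> linear_maps W"
  shows "(\<lambda>x\<in>carrier R. f (h x)) \<in> linear_maps W'"
  by (rule linear_mapsI) (use lmod_homD[OF assms(1)] linear_mapsD[OF assms(2)] in simp_all)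

lemma linear_maps_add:
  assumes "left_module S W" "f \<in> linear_maps W" "g \<in> linear_maps W"
  shows "(\<lambda>x\<in>carrier R. f x \<oplus>\<^bsub>W\<^esub> g x) \<in> linear_maps W"
  using abelian_groupE(1)[OF left_module_imp(2)[OF left_module_hom_module[OF assms(1)]], of f g]
    assms(2,3) by (simp add: hom_module_def)

lemma linear_maps_translate:
  assumes "left_module S W" "f \<in> linear_maps W" "a \<in> carrier R"
  shows "(\<lambda>x\<in>carrier R. f (x \<otimes>\<^bsub>R\<^esub> a)) \<in> linear_maps W"
  using left_module.smult_closed[OF left_module_hom_module[OF assms(1)], of a f] assms(2,3)
  by (simp add: hom_module_def)

lemma coind_homI:
  assumes "left_module S W" "f \<in> lmod_hom S W W'"
  shows "(\<lambda>u\<in>carrier (coind W). enc (\<lambda>x\<in>carrier R. f (dec u x))) \<in> lmod_hom R (coind W) (coind W')"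
  by (rule lmod_homI)
    (use lmod_homD[OF assms(2)] in \<open>auto simp: carrier_coind linear_maps_postcompose[OF assms(2)]
      linear_maps_add[OF assms(1)] linear_maps_translate[OF assms(1)] linear_mapsD
      intro!: restrict_ext\<close>)

lemma linear_maps_orbit:
  assumes "left_module R V" "v \<in> carrier V"
  shows "(\<lambda>x\<in>carrier R. x \<odot>\<^bsub>V\<^esub> v) \<in> linear_maps (res V)"
proof -
  interpret V: left_module R V by fact
  show ?thesis
    by (rule linear_mapsI)
      (use assms(2) in \<open>simp_all add: V.smult_closed V.smult_l_distr V.smult_assoc\<close>)
qed

lemma unit_hom:
  assumes "left_module R V"
  shows "(\<lambda>v\<in>carrier V. enc (\<lambda>x\<in>carrier R. x \<odot>\<^bsub>V\<^esub> v)) \<in> lmod_hom R V (coind (res V))"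
proof -
  interpret V: left_module R V by fact
  show ?thesis
    by (rule lmod_homI) (auto simp: linear_maps_orbit[OF assms] V.smult_closed V.smult_r_distr
        V.smult_assoc intro!: restrict_ext)
qed

lemma counit_hom:
  assumes "left_module S W"
  shows "(\<lambda>u\<in>carrier (coind W). dec u \<one>\<^bsub>R\<^esub>) \<in> lmod_hom S (res (coind W)) W"
proof (rule lmod_homI)
  fix s u assume s: "s \<in> carrier S" and "u \<in> carrier (res (coind W))"
  then obtain f where u: "u = enc f" and f: "f \<in> linear_maps W" by (auto simp: carrier_coind)
  \<comment> \<open>The action of \<open>s\<close> on \<open>f\<close> multiplies arguments on the right, but at \<open>1\<close> this is the same as on
    the left: \<open>f (1 s) = f (s 1) = s f(1)\<close>.\<close>
  have "f s = s \<odot>\<^bsub>W\<^esub> f \<one>\<^bsub>R\<^esub>" using linear_mapsD(3)[OF f s R.one_closed] s by simp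
  then show "(\<lambda>u\<in>carrier (coind W). dec u \<one>\<^bsub>R\<^esub>) (s \<odot>\<^bsub>res (coind W)\<^esub> u) =
      s \<odot>\<^bsub>W\<^esub> (\<lambda>u\<in>carrier (coind W). dec u \<one>\<^bsub>R\<^esub>) u"
    using s f by (simp add: u linear_maps_translate[OF assms])
qed (auto simp: carrier_coind linear_maps_add[OF assms] linear_mapsD)

lemma coinduction_functor_simps [simp]:
  "map_obj (coinduction_functor R S enc) W = coind W"
  "map_arr (coinduction_functor R S enc) (W, f, W') = (coind W,
     \<lambda>u\<in>carrier (coind W). enc (\<lambda>x\<in>carrier R. f (dec u x)), coind W')"
  by (simp_all add: coinduction_functor_def)

lemma is_functor_restriction: "is_functor (module_cat R) (module_cat S) (restriction_functor S)"
  by (auto simp: is_functor_def is_category_module_cat Hom_def left_module_res lmod_hom_res)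

lemma is_functor_coinduction:
  "is_functor (module_cat S) (module_cat R) (coinduction_functor R S enc)"
proof -
  have ident: "(\<lambda>u\<in>carrier (coind W). enc (\<lambda>x\<in>carrier R. (\<lambda>w\<in>carrier W. w) (dec u x))) =
      (\<lambda>u\<in>carrier (coind W). u)" for W :: "('r, 'u) module"
  proof (rule restrict_ext)
    fix u assume "u \<in> carrier (coind W)"
    then obtain f where u: "u = enc f" and f: "f \<in> linear_maps W" by (rule carrier_coindE)
    have "(\<lambda>x\<in>carrier R. (\<lambda>w\<in>carrier W. w) (f x)) = (\<lambda>x\<in>carrier R. f x)"
      by (rule restrict_ext) (simp add: linear_mapsD[OF f])
    then show "enc (\<lambda>x\<in>carrier R. (\<lambda>w\<in>carrier W. w) (dec u x)) = u"
      using f by (simp add: u)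
  qed
  have comp: "(\<lambda>u\<in>carrier (coind W). enc (\<lambda>x\<in>carrier R. compose (carrier W) g f (dec u x))) =
      compose (carrier (coind W))
        (\<lambda>u\<in>carrier (coind W'). enc (\<lambda>x\<in>carrier R. g (dec u x)))
        (\<lambda>u\<in>carrier (coind W). enc (\<lambda>x\<in>carrier R. f (dec u x)))"
    if "f \<in> lmod_hom S W W'" for W W' :: "('r, 'u) module" and f g
    unfolding compose_def
    by (rule restrict_ext) (auto elim!: carrier_coindE simp: linear_maps_postcompose[OF that]
        linear_mapsD intro!: restrict_ext)
  show ?thesis
    unfolding is_functor_def
    by (auto simp: is_category_module_cat Hom_def left_module_coind coind_homI comp
        simp del: restrict_apply intro!: ident)
qed

theorem restriction_coinduction_adjunction:
  "is_adjunction (module_cat R) (module_cat S) (restriction_functor S) (coinduction_functor R S enc)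
     (coinduction_unit R S enc) (coinduction_counit R S enc)"
  unfolding is_adjunction_def
proof (intro conjI)
  note [simp] = left_module_res left_module_coind unit_hom counit_hom lmod_hom_res coind_homI
    is_category_module_cat is_functor_id
  let ?C = "module_cat R" and ?D = "module_cat S"
  let ?L = "restriction_functor S" and ?R = "coinduction_functor R S enc"
  show "is_functor ?C ?D ?L" by (rule is_functor_restriction)
  show "is_functor ?D ?C ?R" by (rule is_functor_coinduction)
  have RL: "is_functor ?C ?C (?R \<circ>\<^sub>F ?L)"
    by (rule is_functor_comp[OF is_functor_restriction is_functor_coinduction])
  have LR: "is_functor ?D ?D (?L \<circ>\<^sub>F ?R)"
    by (rule is_functor_comp[OF is_functor_coinduction is_functor_restriction])
  show "is_nat_trans ?C ?C id_functor (?R \<circ>\<^sub>F ?L) (coinduction_unit R S enc)"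
    unfolding is_nat_trans_def using RL
    by (auto simp: coinduction_unit_def Hom_def compose_def linear_maps_orbit lmod_homD
        intro!: restrict_ext)
  show "is_nat_trans ?D ?D (?L \<circ>\<^sub>F ?R) id_functor (coinduction_counit R S enc)"
    unfolding is_nat_trans_def using LR
    by (auto simp: coinduction_counit_def Hom_def compose_def lmod_homD elim!: carrier_coindE simp: linear_maps_postcompose intro!: restrict_ext)
  show "\<forall>X\<in>Obj ?C. Comp ?D (coinduction_counit R S enc (map_obj ?L X))
      (map_arr ?L (coinduction_unit R S enc X)) = Ident ?D (map_obj ?L X)"
    by (auto simp: coinduction_counit_def coinduction_unit_def compose_def linear_maps_orbit
        left_module.smult_one intro!: restrict_ext)
  \<comment> \<open>The unit sends \<open>f\<close> to \<open>x \<mapsto> x f\<close>, and the counit evaluates \<open>x f\<close> at \<open>1\<close>, which gives back \<open>f x\<close>.\<close>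
  have "compose (carrier (coind Z))
      (\<lambda>u\<in>carrier (coind (res (coind Z))).
        enc (\<lambda>x\<in>carrier R. (\<lambda>u\<in>carrier (coind Z). dec u \<one>\<^bsub>R\<^esub>) (dec u x)))
      (\<lambda>v\<in>carrier (coind Z). enc (\<lambda>x\<in>carrier R. x \<odot>\<^bsub>coind Z\<^esub> v)) = (\<lambda>u\<in>carrier (coind Z). u)"
    if Z: "left_module S Z" for Z :: "('r, 'u) module"
    unfolding compose_def
  proof (rule restrict_ext)
    fix u assume "u \<in> carrier (coind Z)"
    then obtain f where u: "u = enc f" and f: "f \<in> linear_maps Z" by (rule carrier_coindE)
    have orbit: "(\<lambda>x\<in>carrier R. x \<odot>\<^bsub>coind Z\<^esub> u) \<in> linear_maps (res (coind Z))"
      by (rule linear_maps_orbit) (use Z f in \<open>simp_all add: u\<close>)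
    have "(\<lambda>x\<in>carrier R. (\<lambda>u\<in>carrier (coind Z). dec u \<one>\<^bsub>R\<^esub>) ((\<lambda>x\<in>carrier R. x \<odot>\<^bsub>coind Z\<^esub> u) x)) =
        (\<lambda>x\<in>carrier R. f x)"
      by (rule restrict_ext) (simp add: u f linear_maps_translate[OF Z])
    then show "(\<lambda>u\<in>carrier (coind (res (coind Z))).
          enc (\<lambda>x\<in>carrier R. (\<lambda>u\<in>carrier (coind Z). dec u \<one>\<^bsub>R\<^esub>) (dec u x)))
        ((\<lambda>v\<in>carrier (coind Z). enc (\<lambda>x\<in>carrier R. x \<odot>\<^bsub>coind Z\<^esub> v)) u) = u"
      using orbit f \<open>u \<in> carrier (coind Z)\<close>
      by (simp add: restrict_apply' del: restrict_apply) (simp add: u)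
  qed
  then show "\<forall>Z\<in>Obj ?D. Comp ?C (map_arr ?R (coinduction_counit R S enc Z))
      (coinduction_unit R S enc (map_obj ?R Z)) = Ident ?C (map_obj ?R Z)"
    by (simp add: coinduction_counit_def coinduction_unit_def del: restrict_apply)
qed

text \<open>A retraction \<open>\<pi>\<close> of \<open>R\<close> onto \<open>S\<close> that is linear over \<open>S\<close> on both sides splits the counit: the
  element \<open>w\<close> is sent to the map \<open>x \<mapsto> \<pi>(x) w\<close>. Left linearity of \<open>\<pi>\<close> makes this map \<open>S\<close>-linear, right
  linearity makes its dependence on \<open>w\<close> linear, and \<open>\<pi>(1) = 1\<close> makes it a section.\<close>

theorem coinduction_monadic_if_bimodule_retract:
  fixes \<pi> :: "'r \<Rightarrow> 'r"
  assumes closed: "\<And>x. x \<in> carrier R \<Longrightarrow> \<pi> x \<in> carrier S"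
    and add: "\<And>x y. x \<in> carrier R \<Longrightarrow> y \<in> carrier R \<Longrightarrow> \<pi> (x \<oplus>\<^bsub>R\<^esub> y) = \<pi> x \<oplus>\<^bsub>S\<^esub> \<pi> y"
    and left: "\<And>s x. s \<in> carrier S \<Longrightarrow> x \<in> carrier R \<Longrightarrow> \<pi> (s \<otimes>\<^bsub>R\<^esub> x) = s \<otimes>\<^bsub>S\<^esub> \<pi> x"
    and right: "\<And>s x. s \<in> carrier S \<Longrightarrow> x \<in> carrier R \<Longrightarrow> \<pi> (x \<otimes>\<^bsub>R\<^esub> s) = \<pi> x \<otimes>\<^bsub>S\<^esub> s"
    and one: "\<pi> \<one>\<^bsub>R\<^esub> = \<one>\<^bsub>S\<^esub>"
  shows "is_equivalence (module_cat S)
    (monad_module_cat (module_cat R) (monad_of_adjunction (restriction_functor S)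
      (coinduction_functor R S enc) (coinduction_unit R S enc) (coinduction_counit R S enc)))
    (eilenberg_moore_functor (module_cat S) (coinduction_functor R S enc)
      (coinduction_counit R S enc))"
proof -
  interpret adjunction "module_cat R" "module_cat S" "restriction_functor S"
    "coinduction_functor R S enc" "coinduction_unit R S enc" "coinduction_counit R S enc"
    by (rule adjunctionI) (rule restriction_coinduction_adjunction)
  define \<sigma> where "\<sigma> W = (W, \<lambda>w\<in>carrier W. enc (\<lambda>x\<in>carrier R. \<pi> x \<odot>\<^bsub>W\<^esub> w), res (coind W))"
    for W :: "('r, 'u) module"
  have sec_map: "(\<lambda>x\<in>carrier R. \<pi> x \<odot>\<^bsub>W\<^esub> w) \<in> linear_maps W"
    if "left_module S W" "w \<in> carrier W" for W :: "('r, 'u) module" and w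
  proof -
    interpret W: left_module S W by fact
    show ?thesis
      by (rule linear_mapsI)
        (use that(2) in \<open>simp_all add: closed add left W.smult_closed W.smult_l_distr W.smult_assoc\<close>)
  qed
  have sec_hom: "(\<lambda>w\<in>carrier W. enc (\<lambda>x\<in>carrier R. \<pi> x \<odot>\<^bsub>W\<^esub> w)) \<in> lmod_hom S W (res (coind W))"
    if "left_module S W" for W :: "('r, 'u) module"
  proof -
    interpret W: left_module S W by fact
    show ?thesis
      by (rule lmod_homI) (auto simp: sec_map[OF that] W.smult_closed W.smult_r_distr closed right
          W.smult_assoc intro!: restrict_ext)
  qed
  show ?thesis
  proof (rule eilenberg_moore_equivalence_if_counit_splits[where \<sigma> = \<sigma>])
    have LR: "is_functor (module_cat S) (module_cat S)
        (restriction_functor S \<circ>\<^sub>F coinduction_functor R S enc)"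
      by (rule is_functor_comp[OF is_functor_coinduction is_functor_restriction])
    show "is_nat_trans (module_cat S) (module_cat S) id_functor
        (restriction_functor S \<circ>\<^sub>F coinduction_functor R S enc) \<sigma>"
      unfolding is_nat_trans_def using LR
      by (auto simp: \<sigma>_def Hom_def compose_def is_functor_id is_category_module_cat left_module_res
          left_module_coind sec_hom sec_map lmod_homD closed intro!: restrict_ext)
  next
    fix Z :: "('r, 'u) module" assume "Z \<in> Obj (module_cat S)"
    then show "Comp (module_cat S) (coinduction_counit R S enc Z) (\<sigma> Z) = Ident (module_cat S) Z"
      by (auto simp: \<sigma>_def coinduction_counit_def compose_def sec_map one left_module.smult_one
          intro!: restrict_ext)
  qed (rule idempotents_split_module_cat)
qed

end


section \<open>The group algebra\<close>

lemma (in abelian_monoid) finsum_swap: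
  assumes "finite A" "finite B" "\<And>i j. i \<in> A \<Longrightarrow> j \<in> B \<Longrightarrow> f i j \<in> carrier G"
  shows "(\<Oplus>i\<in>A. \<Oplus>j\<in>B. f i j) = (\<Oplus>j\<in>B. \<Oplus>i\<in>A. f i j)"
  using assms(1,3)
proof (induction A)
  case empty
  then show ?case by (simp add: finsum_zero)
next
  case (insert a A)
  have "(\<Oplus>j\<in>B. \<Oplus>i\<in>insert a A. f i j) = (\<Oplus>j\<in>B. f a j \<oplus> (\<Oplus>i\<in>A. f i j))"
    by (rule finsum_cong') (use insert in \<open>auto simp: finsum_insert intro!: finsum_closed\<close>)
  also have "\<dots> = (\<Oplus>j\<in>B. f a j) \<oplus> (\<Oplus>j\<in>B. \<Oplus>i\<in>A. f i j)"
    by (rule finsum_addf) (use insert in \<open>auto intro!: finsum_closed\<close>)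
  also have "\<dots> = (\<Oplus>i\<in>insert a A. \<Oplus>j\<in>B. f i j)"
    using insert by (subst finsum_insert) (auto intro!: finsum_closed)
  finally show ?case by simp
qed

locale group_ring = K: ring k + G: group G
  for k :: "('k, 'm) ring_scheme" and G :: "('g, 'n) monoid_scheme"
begin

abbreviation "KG \<equiv> group_algebra k G"
abbreviation "supp a \<equiv> {x. a x \<noteq> \<zero>\<^bsub>k\<^esub>}"

lemma carrierD:
  assumes "a \<in> carrier KG"
  shows "a x \<in> carrier k" "x \<notin> carrier G \<Longrightarrow> a x = \<zero>\<^bsub>k\<^esub>" "finite (supp a)" "supp a \<subseteq> carrier G"
  using assms by (auto simp: group_algebra_def)

lemma carrierI:
  assumes "\<And>x. x \<in> carrier G \<Longrightarrow> a x \<in> carrier k" "\<And>x. x \<notin> carrier G \<Longrightarrow> a x = \<zero>\<^bsub>k\<^esub>"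
    and "supp a \<subseteq> B" "finite B"
  shows "a \<in> carrier KG"
proof -
  have "a x \<in> carrier k" for x using assms(1,2) by (cases "x \<in> carrier G") auto
  then show ?thesis using assms(2) finite_subset[OF assms(3,4)] by (simp add: group_algebra_def)
qed

lemma add_apply [simp]: "(a \<oplus>\<^bsub>KG\<^esub> b) x = a x \<oplus>\<^bsub>k\<^esub> b x"
  and zero_apply [simp]: "\<zero>\<^bsub>KG\<^esub> x = \<zero>\<^bsub>k\<^esub>"
  and one_apply: "\<one>\<^bsub>KG\<^esub> x = (if x = \<one>\<^bsub>G\<^esub> then \<one>\<^bsub>k\<^esub> else \<zero>\<^bsub>k\<^esub>)"
  and mult_outside [simp]: "x \<notin> carrier G \<Longrightarrow> (a \<otimes>\<^bsub>KG\<^esub> b) x = \<zero>\<^bsub>k\<^esub>"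
  by (simp_all add: group_algebra_def)

text \<open>Summing over any finite set that contains the support of the left factor gives products with
  different supports a common index set.\<close>

lemma mult_apply:
  assumes a: "a \<in> carrier KG" and b: "b \<in> carrier KG" and x: "x \<in> carrier G"
    and B: "finite B" "supp a \<subseteq> B"
  shows "(a \<otimes>\<^bsub>KG\<^esub> b) x = (\<Oplus>\<^bsub>k\<^esub>y\<in>B. a y \<otimes>\<^bsub>k\<^esub> b (inv\<^bsub>G\<^esub> y \<otimes>\<^bsub>G\<^esub> x))"
proof -
  have "(\<Oplus>\<^bsub>k\<^esub>y\<in>supp a. a y \<otimes>\<^bsub>k\<^esub> b (inv\<^bsub>G\<^esub> y \<otimes>\<^bsub>G\<^esub> x)) =
      (\<Oplus>\<^bsub>k\<^esub>y\<in>B. a y \<otimes>\<^bsub>k\<^esub> b (inv\<^bsub>G\<^esub> y \<otimes>\<^bsub>G\<^esub> x))"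
    by (rule K.add.finprod_mono_neutral_cong_left)
      (use B carrierD(1)[OF a] carrierD(1)[OF b] in auto)
  then show ?thesis using x by (simp add: group_algebra_def)
qed

lemma mult_supp:
  assumes a: "a \<in> carrier KG" and b: "b \<in> carrier KG"
  shows "supp (a \<otimes>\<^bsub>KG\<^esub> b) \<subseteq> (\<lambda>(y, z). y \<otimes>\<^bsub>G\<^esub> z) ` (supp a \<times> supp b)"
proof
  fix x assume "x \<in> supp (a \<otimes>\<^bsub>KG\<^esub> b)"
  then have nz: "(a \<otimes>\<^bsub>KG\<^esub> b) x \<noteq> \<zero>\<^bsub>k\<^esub>" by simp
  then have x: "x \<in> carrier G" using mult_outside by blast
  have "\<exists>y\<in>supp a. a y \<otimes>\<^bsub>k\<^esub> b (inv\<^bsub>G\<^esub> y \<otimes>\<^bsub>G\<^esub> x) \<noteq> \<zero>\<^bsub>k\<^esub>"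
  proof (rule ccontr)
    assume "\<not> ?thesis"
    then have "(\<Oplus>\<^bsub>k\<^esub>y\<in>supp a. a y \<otimes>\<^bsub>k\<^esub> b (inv\<^bsub>G\<^esub> y \<otimes>\<^bsub>G\<^esub> x)) = \<zero>\<^bsub>k\<^esub>"
      by (intro K.add.finprod_one_eqI) blast
    then show False using nz mult_apply[OF a b x carrierD(3)[OF a]] by simp
  qed
  then obtain y where y: "y \<in> supp a" "a y \<otimes>\<^bsub>k\<^esub> b (inv\<^bsub>G\<^esub> y \<otimes>\<^bsub>G\<^esub> x) \<noteq> \<zero>\<^bsub>k\<^esub>" by blast
  have "inv\<^bsub>G\<^esub> y \<otimes>\<^bsub>G\<^esub> x \<in> supp b" using y(2) carrierD(1)[OF a] by auto
  moreover have "x = y \<otimes>\<^bsub>G\<^esub> (inv\<^bsub>G\<^esub> y \<otimes>\<^bsub>G\<^esub> x)"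
    using y(1) carrierD(4)[OF a] x by (auto simp: G.m_assoc[symmetric])
  ultimately show "x \<in> (\<lambda>(y, z). y \<otimes>\<^bsub>G\<^esub> z) ` (supp a \<times> supp b)"
    using y(1) by (auto intro!: image_eqI[of _ _ "(y, inv\<^bsub>G\<^esub> y \<otimes>\<^bsub>G\<^esub> x)"])
qed

lemma mult_closed:
  assumes a: "a \<in> carrier KG" and b: "b \<in> carrier KG"
  shows "a \<otimes>\<^bsub>KG\<^esub> b \<in> carrier KG"
proof (rule carrierI[OF _ _ mult_supp[OF a b]])
  fix x assume "x \<in> carrier G"
  then show "(a \<otimes>\<^bsub>KG\<^esub> b) x \<in> carrier k"
    by (subst mult_apply[OF a b _ carrierD(3)[OF a] order_refl])
      (use carrierD(1)[OF a] carrierD(1)[OF b] in \<open>auto intro!: K.finsum_closed\<close>)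
qed (use carrierD(3)[OF a] carrierD(3)[OF b] in auto)

text \<open>Both bracketings are the sum of \<open>a(z) b(w) c(inv (z w) x)\<close> over the pairs of support points \<open>z\<close>, \<open>w\<close>.
  The left one is indexed by \<open>z\<close> and \<open>y = z w\<close>; swapping the two sums and substituting \<open>y = z w\<close> for
  fixed \<open>z\<close> turns it into the right one.\<close>

lemma mult_assoc:
  assumes a: "a \<in> carrier KG" and b: "b \<in> carrier KG" and c: "c \<in> carrier KG"
  shows "(a \<otimes>\<^bsub>KG\<^esub> b) \<otimes>\<^bsub>KG\<^esub> c = a \<otimes>\<^bsub>KG\<^esub> (b \<otimes>\<^bsub>KG\<^esub> c)"
proof
  fix x
  show "((a \<otimes>\<^bsub>KG\<^esub> b) \<otimes>\<^bsub>KG\<^esub> c) x = (a \<otimes>\<^bsub>KG\<^esub> (b \<otimes>\<^bsub>KG\<^esub> c)) x"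
  proof (cases "x \<in> carrier G")
    case x: True
    let ?P = "(\<lambda>(y, z). y \<otimes>\<^bsub>G\<^esub> z) ` (supp a \<times> supp b)"
    note [simp] = carrierD(1)[OF a] carrierD(1)[OF b] carrierD(1)[OF c]
      carrierD(3)[OF a] carrierD(3)[OF b]
    have inG [simp]: "z \<in> carrier G" if "a z \<noteq> \<zero>\<^bsub>k\<^esub> \<or> b z \<noteq> \<zero>\<^bsub>k\<^esub>" for z
      using that carrierD(2)[OF a] carrierD(2)[OF b] by blast
    have P [simp]: "finite ?P" "y \<in> ?P \<Longrightarrow> y \<in> carrier G" for y by auto
    let ?t = "\<lambda>z y. a z \<otimes>\<^bsub>k\<^esub> b (inv\<^bsub>G\<^esub> z \<otimes>\<^bsub>G\<^esub> y) \<otimes>\<^bsub>k\<^esub> c (inv\<^bsub>G\<^esub> y \<otimes>\<^bsub>G\<^esub> x)"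
    have inner: "(\<Oplus>\<^bsub>k\<^esub>y\<in>?P. ?t z y) = a z \<otimes>\<^bsub>k\<^esub> (b \<otimes>\<^bsub>KG\<^esub> c) (inv\<^bsub>G\<^esub> z \<otimes>\<^bsub>G\<^esub> x)"
      if z: "z \<in> supp a" for z
    proof -
      have zG: "z \<in> carrier G" using z by simp
      have "(\<Oplus>\<^bsub>k\<^esub>y\<in>?P. ?t z y) = (\<Oplus>\<^bsub>k\<^esub>y\<in>(\<lambda>w. z \<otimes>\<^bsub>G\<^esub> w) ` supp b. ?t z y)"
      proof (rule K.add.finprod_mono_neutral_cong_right)
        show "?t z y = \<zero>\<^bsub>k\<^esub>" if y: "y \<in> ?P - (\<lambda>w. z \<otimes>\<^bsub>G\<^esub> w) ` supp b" for y
        proof -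
          have "y \<in> carrier G" using y P(2) by blast
          then have "y = z \<otimes>\<^bsub>G\<^esub> (inv\<^bsub>G\<^esub> z \<otimes>\<^bsub>G\<^esub> y)" using zG by (simp add: G.m_assoc[symmetric])
          then have "b (inv\<^bsub>G\<^esub> z \<otimes>\<^bsub>G\<^esub> y) = \<zero>\<^bsub>k\<^esub>" using y by blast
          then show "?t z y = \<zero>\<^bsub>k\<^esub>" by simp
        qed
      qed (use z in auto)
      also have "\<dots> = (\<Oplus>\<^bsub>k\<^esub>w\<in>supp b. ?t z (z \<otimes>\<^bsub>G\<^esub> w))"
        by (rule K.finsum_reindex) (use zG in \<open>auto simp: inj_on_def\<close>)
      also have "\<dots> = (\<Oplus>\<^bsub>k\<^esub>w\<in>supp b.
          a z \<otimes>\<^bsub>k\<^esub> (b w \<otimes>\<^bsub>k\<^esub> c (inv\<^bsub>G\<^esub> w \<otimes>\<^bsub>G\<^esub> (inv\<^bsub>G\<^esub> z \<otimes>\<^bsub>G\<^esub> x))))"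
      proof (rule K.finsum_cong')
        fix w assume "w \<in> supp b"
        then have w: "w \<in> carrier G" by simp
        then have "inv\<^bsub>G\<^esub> z \<otimes>\<^bsub>G\<^esub> (z \<otimes>\<^bsub>G\<^esub> w) = w" using zG by (simp add: G.m_assoc[symmetric])
        moreover have "inv\<^bsub>G\<^esub> (z \<otimes>\<^bsub>G\<^esub> w) \<otimes>\<^bsub>G\<^esub> x = inv\<^bsub>G\<^esub> w \<otimes>\<^bsub>G\<^esub> (inv\<^bsub>G\<^esub> z \<otimes>\<^bsub>G\<^esub> x)"
          using zG w x by (simp add: G.inv_mult_group G.m_assoc)
        ultimately show "?t z (z \<otimes>\<^bsub>G\<^esub> w) =
            a z \<otimes>\<^bsub>k\<^esub> (b w \<otimes>\<^bsub>k\<^esub> c (inv\<^bsub>G\<^esub> w \<otimes>\<^bsub>G\<^esub> (inv\<^bsub>G\<^esub> z \<otimes>\<^bsub>G\<^esub> x)))"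
          by (simp add: K.m_assoc)
      qed auto
      also have "\<dots> = a z \<otimes>\<^bsub>k\<^esub> (b \<otimes>\<^bsub>KG\<^esub> c) (inv\<^bsub>G\<^esub> z \<otimes>\<^bsub>G\<^esub> x)"
        using zG x by (subst mult_apply[OF b c _ _ order_refl]) (auto intro!: K.finsum_rdistr[symmetric])
      finally show ?thesis .
    qed
    have "((a \<otimes>\<^bsub>KG\<^esub> b) \<otimes>\<^bsub>KG\<^esub> c) x = (\<Oplus>\<^bsub>k\<^esub>y\<in>?P. (a \<otimes>\<^bsub>KG\<^esub> b) y \<otimes>\<^bsub>k\<^esub> c (inv\<^bsub>G\<^esub> y \<otimes>\<^bsub>G\<^esub> x))"
      by (rule mult_apply[OF mult_closed[OF a b] c x P(1) mult_supp[OF a b]])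
    also have "\<dots> = (\<Oplus>\<^bsub>k\<^esub>y\<in>?P. \<Oplus>\<^bsub>k\<^esub>z\<in>supp a. ?t z y)"
    proof (rule K.finsum_cong')
      fix y assume "y \<in> ?P"
      then have "y \<in> carrier G" by (rule P(2))
      then show "(a \<otimes>\<^bsub>KG\<^esub> b) y \<otimes>\<^bsub>k\<^esub> c (inv\<^bsub>G\<^esub> y \<otimes>\<^bsub>G\<^esub> x) = (\<Oplus>\<^bsub>k\<^esub>z\<in>supp a. ?t z y)"
        by (subst mult_apply[OF a b _ _ order_refl]) (auto intro!: K.finsum_ldistr)
    qed (auto intro!: K.finsum_closed)
    also have "\<dots> = (\<Oplus>\<^bsub>k\<^esub>z\<in>supp a. \<Oplus>\<^bsub>k\<^esub>y\<in>?P. ?t z y)"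
      by (rule K.finsum_swap) auto
    also have "\<dots> = (\<Oplus>\<^bsub>k\<^esub>z\<in>supp a. a z \<otimes>\<^bsub>k\<^esub> (b \<otimes>\<^bsub>KG\<^esub> c) (inv\<^bsub>G\<^esub> z \<otimes>\<^bsub>G\<^esub> x))"
      by (rule K.finsum_cong') (use inner carrierD(1)[OF mult_closed[OF b c]] in auto)
    also have "\<dots> = (a \<otimes>\<^bsub>KG\<^esub> (b \<otimes>\<^bsub>KG\<^esub> c)) x"
      by (rule mult_apply[OF a mult_closed[OF b c] x _ order_refl, symmetric]) simp
    finally show ?thesis .
  qed simp
qed

lemma one_closed: "\<one>\<^bsub>KG\<^esub> \<in> carrier KG"
  by (rule carrierI[where B = "{\<one>\<^bsub>G\<^esub>}"]) (auto simp: one_apply)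

lemma add_closed:
  assumes a: "a \<in> carrier KG" and b: "b \<in> carrier KG"
  shows "a \<oplus>\<^bsub>KG\<^esub> b \<in> carrier KG"
  by (rule carrierI[where B = "supp a \<union> supp b"]) (use carrierD[OF a] carrierD[OF b] in auto)

lemma one_mult:
  assumes a: "a \<in> carrier KG"
  shows "\<one>\<^bsub>KG\<^esub> \<otimes>\<^bsub>KG\<^esub> a = a"
proof
  fix x
  show "(\<one>\<^bsub>KG\<^esub> \<otimes>\<^bsub>KG\<^esub> a) x = a x"
  proof (cases "x \<in> carrier G")
    case True
    then have "(\<one>\<^bsub>KG\<^esub> \<otimes>\<^bsub>KG\<^esub> a) x = (\<Oplus>\<^bsub>k\<^esub>y\<in>{\<one>\<^bsub>G\<^esub>}. \<one>\<^bsub>KG\<^esub> y \<otimes>\<^bsub>k\<^esub> a (inv\<^bsub>G\<^esub> y \<otimes>\<^bsub>G\<^esub> x))"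
      by (intro mult_apply one_closed a) (auto simp: one_apply)
    then show ?thesis using True carrierD(1)[OF a] by (simp add: one_apply K.finsum_insert K.finsum_empty)
  qed (simp add: carrierD(2)[OF a])
qed

lemma mult_one:
  assumes a: "a \<in> carrier KG"
  shows "a \<otimes>\<^bsub>KG\<^esub> \<one>\<^bsub>KG\<^esub> = a"
proof
  fix x
  show "(a \<otimes>\<^bsub>KG\<^esub> \<one>\<^bsub>KG\<^esub>) x = a x"
  proof (cases "x \<in> carrier G")
    case x: True
    \<comment> \<open>The only summand that can be nonzero is the one at \<open>x\<close>, which need not lie in the support.\<close>
    let ?B = "insert x (supp a)"
    have B: "finite ?B" "supp a \<subseteq> ?B" using carrierD(3)[OF a] by auto
    have "(a \<otimes>\<^bsub>KG\<^esub> \<one>\<^bsub>KG\<^esub>) x = (\<Oplus>\<^bsub>k\<^esub>y\<in>?B. a y \<otimes>\<^bsub>k\<^esub> \<one>\<^bsub>KG\<^esub> (inv\<^bsub>G\<^esub> y \<otimes>\<^bsub>G\<^esub> x))"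
      by (rule mult_apply[OF a one_closed x B])
    also have "\<dots> = (\<Oplus>\<^bsub>k\<^esub>y\<in>?B. if x = y then a y else \<zero>\<^bsub>k\<^esub>)"
    proof (rule K.finsum_cong')
      fix y assume "y \<in> ?B"
      then have y: "y \<in> carrier G" using x carrierD(4)[OF a] by auto
      have "inv\<^bsub>G\<^esub> y \<otimes>\<^bsub>G\<^esub> x = \<one>\<^bsub>G\<^esub> \<longleftrightarrow> x = y"
        using x y by (metis G.inv_closed G.inv_equality G.inv_inv G.l_inv)
      then show "a y \<otimes>\<^bsub>k\<^esub> \<one>\<^bsub>KG\<^esub> (inv\<^bsub>G\<^esub> y \<otimes>\<^bsub>G\<^esub> x) = (if x = y then a y else \<zero>\<^bsub>k\<^esub>)"
        using carrierD(1)[OF a] by (simp add: one_apply)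
    qed (use carrierD(1)[OF a] in auto)
    also have "\<dots> = a x"
      by (rule K.finsum_singleton) (use B carrierD(1)[OF a] in auto)
    finally show ?thesis .
  qed (simp add: carrierD(2)[OF a])
qed

lemma distribs:
  assumes a: "a \<in> carrier KG" and b: "b \<in> carrier KG" and c: "c \<in> carrier KG"
  shows "(a \<oplus>\<^bsub>KG\<^esub> b) \<otimes>\<^bsub>KG\<^esub> c = a \<otimes>\<^bsub>KG\<^esub> c \<oplus>\<^bsub>KG\<^esub> b \<otimes>\<^bsub>KG\<^esub> c"
    and "c \<otimes>\<^bsub>KG\<^esub> (a \<oplus>\<^bsub>KG\<^esub> b) = c \<otimes>\<^bsub>KG\<^esub> a \<oplus>\<^bsub>KG\<^esub> c \<otimes>\<^bsub>KG\<^esub> b"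
proof -
  note [simp] = carrierD(1)[OF a] carrierD(1)[OF b] carrierD(1)[OF c]
  let ?B = "supp a \<union> supp b"
  have B: "finite ?B" "supp a \<subseteq> ?B" "supp b \<subseteq> ?B" "supp (a \<oplus>\<^bsub>KG\<^esub> b) \<subseteq> ?B"
    using carrierD(3)[OF a] carrierD(3)[OF b] by auto
  note ab = add_closed[OF a b]
  show "(a \<oplus>\<^bsub>KG\<^esub> b) \<otimes>\<^bsub>KG\<^esub> c = a \<otimes>\<^bsub>KG\<^esub> c \<oplus>\<^bsub>KG\<^esub> b \<otimes>\<^bsub>KG\<^esub> c"
  proof
    fix x
    show "((a \<oplus>\<^bsub>KG\<^esub> b) \<otimes>\<^bsub>KG\<^esub> c) x = (a \<otimes>\<^bsub>KG\<^esub> c \<oplus>\<^bsub>KG\<^esub> b \<otimes>\<^bsub>KG\<^esub> c) x"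
      by (cases "x \<in> carrier G")
        (simp_all add: mult_apply[OF ab c _ B(1,4)] mult_apply[OF a c _ B(1,2)]
          mult_apply[OF b c _ B(1,3)] K.l_distr K.finsum_addf)
  qed
  note C = carrierD(3)[OF c] order_refl[of "supp c"]
  show "c \<otimes>\<^bsub>KG\<^esub> (a \<oplus>\<^bsub>KG\<^esub> b) = c \<otimes>\<^bsub>KG\<^esub> a \<oplus>\<^bsub>KG\<^esub> c \<otimes>\<^bsub>KG\<^esub> b"
  proof
    fix x
    show "(c \<otimes>\<^bsub>KG\<^esub> (a \<oplus>\<^bsub>KG\<^esub> b)) x = (c \<otimes>\<^bsub>KG\<^esub> a \<oplus>\<^bsub>KG\<^esub> c \<otimes>\<^bsub>KG\<^esub> b) x"
      by (cases "x \<in> carrier G")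
        (simp_all add: mult_apply[OF c ab _ C] mult_apply[OF c a _ C] mult_apply[OF c b _ C]
          K.r_distr K.finsum_addf)
  qed
qed

theorem ring_group_algebra: "ring KG"
proof (rule ringI)
  show "abelian_group KG"
  proof (rule abelian_groupI)
    fix a assume a: "a \<in> carrier KG"
    have "(\<lambda>x. \<ominus>\<^bsub>k\<^esub> a x) \<in> carrier KG"
      by (rule carrierI[where B = "supp a"]) (use carrierD[OF a] in auto)
    then show "\<exists>b\<in>carrier KG. b \<oplus>\<^bsub>KG\<^esub> a = \<zero>\<^bsub>KG\<^esub>"
      by (rule bexI[rotated]) (use carrierD(1)[OF a] in \<open>auto simp: fun_eq_iff K.l_neg\<close>)
  next
    show "\<zero>\<^bsub>KG\<^esub> \<in> carrier KG" by (rule carrierI[where B = "{}"]) auto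
  qed (auto simp: fun_eq_iff carrierD(1) K.a_ac add_closed)
  show "Group.monoid KG"
    by (rule monoidI) (auto simp: mult_closed one_closed mult_assoc one_mult mult_one)
qed (auto simp: distribs)

end


section \<open>The subgroup algebra is a bimodule retract\<close>

locale group_ring_subgroup = group_ring k G + subgroup H G
  for k :: "('k, 'm) ring_scheme" and G :: "('g, 'n) monoid_scheme" and H :: "'g set"
begin

abbreviation "KH \<equiv> subgroup_algebra k G H"

sublocale H: group_ring k "G\<lparr>carrier := H\<rparr>"
  by (intro group_ring.intro K.ring_axioms subgroup_is_group G.is_group)

definition cutoff :: "('g \<Rightarrow> 'k) \<Rightarrow> 'g \<Rightarrow> 'k" where
  "cutoff a x = (if x \<in> H then a x else \<zero>\<^bsub>k\<^esub>)"

lemma inv_mult_mem_iff: "h \<in> H \<Longrightarrow> y \<in> carrier G \<Longrightarrow> inv\<^bsub>G\<^esub> y \<otimes>\<^bsub>G\<^esub> h \<in> H \<longleftrightarrow> y \<in> H"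
  by (metis G.inv_closed G.inv_inv G.inv_solve_right' m_closed m_inv_closed mem_carrier)

lemma mult_inv_mem_iff: "y \<in> H \<Longrightarrow> x \<in> carrier G \<Longrightarrow> inv\<^bsub>G\<^esub> y \<otimes>\<^bsub>G\<^esub> x \<in> H \<longleftrightarrow> x \<in> H"
  by (metis G.inv_closed G.inv_solve_left' m_closed m_inv_closed mem_carrier)

lemma KH_subset: "carrier KH \<subseteq> carrier KG"
  using subset by (auto simp: group_algebra_def)

lemma KH_mult:
  assumes a: "a \<in> carrier KH" and b: "b \<in> carrier KH"
  shows "a \<otimes>\<^bsub>KH\<^esub> b = a \<otimes>\<^bsub>KG\<^esub> b"
proof
  fix x
  have aG: "a \<in> carrier KG" and bG: "b \<in> carrier KG" using a b KH_subset by auto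
  note [simp] = carrierD(1)[OF aG] carrierD(1)[OF bG]
  have supp: "supp a \<subseteq> H" using H.carrierD(4)[OF a] by simp
  show "(a \<otimes>\<^bsub>KH\<^esub> b) x = (a \<otimes>\<^bsub>KG\<^esub> b) x"
  proof (cases "x \<in> H")
    case True
    then show ?thesis
      using H.mult_apply[OF a b _ H.carrierD(3)[OF a] order_refl, of x]
        mult_apply[OF aG bG _ H.carrierD(3)[OF a] order_refl, of x] supp
      by (auto simp: G.m_inv_consistent[OF subgroup_axioms] intro!: K.finsum_cong')
  next
    case False
    have "(a \<otimes>\<^bsub>KG\<^esub> b) x = \<zero>\<^bsub>k\<^esub>"
    proof (cases "x \<in> carrier G")
      case True
      have "b (inv\<^bsub>G\<^esub> y \<otimes>\<^bsub>G\<^esub> x) = \<zero>\<^bsub>k\<^esub>" if "y \<in> supp a" for y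
        using H.carrierD(2)[OF b] mult_inv_mem_iff[of y x] supp that True False by auto
      then show ?thesis
        by (subst mult_apply[OF aG bG True carrierD(3)[OF aG] order_refl])
          (auto intro!: K.add.finprod_one_eqI)
    qed simp
    with False show ?thesis by simp
  qed
qed

lemma ring_extension_KH:
  assumes "inj enc"
  shows "ring_extension KG KH enc"
proof (intro ring_extension.intro ring_extension_axioms.intro)
  show "ring KG" by (rule ring_group_algebra)
  show "ring KH" by (rule H.ring_group_algebra)
  show "carrier KH \<subseteq> carrier KG" by (rule KH_subset)
qed (use assms in \<open>auto simp: KH_mult fun_eq_iff one_apply H.one_apply\<close>)

lemma cutoff_closed:
  assumes "a \<in> carrier KG"
  shows "cutoff a \<in> carrier KH"
  by (rule H.carrierI[where B = "supp a"]) (use carrierD[OF assms] in \<open>auto simp: cutoff_def\<close>)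

text \<open>Functions supported on \<open>H\<close> and functions supported on its complement are both stable under
  convolution from either side with functions supported on \<open>H\<close>, because translations by elements of
  \<open>H\<close> preserve \<open>H\<close> and its complement. So cutting a function off outside \<open>H\<close> commutes with both
  convolutions.\<close>

lemma cutoff_mult_left:
  assumes s: "s \<in> carrier KH" and a: "a \<in> carrier KG"
  shows "cutoff (s \<otimes>\<^bsub>KG\<^esub> a) = s \<otimes>\<^bsub>KH\<^esub> cutoff a"
proof
  fix x
  have sG: "s \<in> carrier KG" and cG: "cutoff a \<in> carrier KG"
    using s cutoff_closed[OF a] KH_subset by auto
  have supp: "supp s \<subseteq> H" using H.carrierD(4)[OF s] by simp
  show "cutoff (s \<otimes>\<^bsub>KG\<^esub> a) x = (s \<otimes>\<^bsub>KH\<^esub> cutoff a) x"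
  proof (cases "x \<in> H")
    case True
    have "(\<Oplus>\<^bsub>k\<^esub>y\<in>supp s. s y \<otimes>\<^bsub>k\<^esub> a (inv\<^bsub>G\<^esub> y \<otimes>\<^bsub>G\<^esub> x)) =
        (\<Oplus>\<^bsub>k\<^esub>y\<in>supp s. s y \<otimes>\<^bsub>k\<^esub> cutoff a (inv\<^bsub>G\<^esub> y \<otimes>\<^bsub>G\<^esub> x))"
      by (rule K.finsum_cong')
        (use supp True carrierD(1)[OF a] carrierD(1)[OF sG] in \<open>auto simp: cutoff_def\<close>)
    then show ?thesis
      using True
      by (simp add: KH_mult[OF s cutoff_closed[OF a]] cutoff_def[of "s \<otimes>\<^bsub>KG\<^esub> a"]
          mult_apply[OF sG a _ carrierD(3)[OF sG] order_refl]
          mult_apply[OF sG cG _ carrierD(3)[OF sG] order_refl])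
  next
    case False
    then show ?thesis by (simp add: cutoff_def[of "s \<otimes>\<^bsub>KG\<^esub> a"])
  qed
qed

lemma cutoff_mult_right:
  assumes s: "s \<in> carrier KH" and a: "a \<in> carrier KG"
  shows "cutoff (a \<otimes>\<^bsub>KG\<^esub> s) = cutoff a \<otimes>\<^bsub>KH\<^esub> s"
proof
  fix x
  have sG: "s \<in> carrier KG" and cG: "cutoff a \<in> carrier KG"
    using s cutoff_closed[OF a] KH_subset by auto
  have supp: "supp (cutoff a) \<subseteq> supp a" by (auto simp: cutoff_def)
  show "cutoff (a \<otimes>\<^bsub>KG\<^esub> s) x = (cutoff a \<otimes>\<^bsub>KH\<^esub> s) x"
  proof (cases "x \<in> H")
    case True
    have "a y \<otimes>\<^bsub>k\<^esub> s (inv\<^bsub>G\<^esub> y \<otimes>\<^bsub>G\<^esub> x) = cutoff a y \<otimes>\<^bsub>k\<^esub> s (inv\<^bsub>G\<^esub> y \<otimes>\<^bsub>G\<^esub> x)"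
      if "y \<in> supp a" for y
    proof (cases "y \<in> H")
      case False
      have "y \<in> carrier G" using that carrierD(4)[OF a] by blast
      then have "s (inv\<^bsub>G\<^esub> y \<otimes>\<^bsub>G\<^esub> x) = \<zero>\<^bsub>k\<^esub>"
        using False True inv_mult_mem_iff H.carrierD(2)[OF s] by simp
      then show ?thesis using carrierD(1)[OF a] carrierD(1)[OF cG] by simp
    qed (simp add: cutoff_def)
    then have "(\<Oplus>\<^bsub>k\<^esub>y\<in>supp a. a y \<otimes>\<^bsub>k\<^esub> s (inv\<^bsub>G\<^esub> y \<otimes>\<^bsub>G\<^esub> x)) =
        (\<Oplus>\<^bsub>k\<^esub>y\<in>supp a. cutoff a y \<otimes>\<^bsub>k\<^esub> s (inv\<^bsub>G\<^esub> y \<otimes>\<^bsub>G\<^esub> x))"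
      by (intro K.finsum_cong') (use carrierD(1)[OF cG] carrierD(1)[OF sG] in auto)
    then show ?thesis
      using True
      by (simp add: KH_mult[OF cutoff_closed[OF a] s] cutoff_def[of "a \<otimes>\<^bsub>KG\<^esub> s"]
          mult_apply[OF a sG _ carrierD(3)[OF a] order_refl]
          mult_apply[OF cG sG _ carrierD(3)[OF a] supp])
  next
    case False
    then show ?thesis by (simp add: cutoff_def[of "a \<otimes>\<^bsub>KG\<^esub> s"])
  qed
qed

end

section \<open>Monadicity of coinduction from a subgroup\<close>

lemma Res_eq: "Res k G H = restriction_functor (subgroup_algebra k G H)"
  by (simp add: Res_def restriction_functor_def Let_def)

lemma CoInd_eq:
  "CoInd k G H enc = coinduction_functor (group_algebra k G) (subgroup_algebra k G H) enc"
  by (simp add: CoInd_def coinduction_functor_def Let_def)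

lemma res_coind_unit_eq:
  "res_coind_unit k G H enc = coinduction_unit (group_algebra k G) (subgroup_algebra k G H) enc"
  by (rule ext) (simp add: res_coind_unit_def coinduction_unit_def Res_def CoInd_def Let_def)

lemma res_coind_counit_eq:
  "res_coind_counit k G H enc = coinduction_counit (group_algebra k G) (subgroup_algebra k G H) enc"
  by (rule ext) (simp add: res_coind_counit_def coinduction_counit_def Res_def CoInd_def Let_def)

theorem theorem3p5:
  fixes k :: "('k, 'm) ring_scheme"
    and G :: "('g, 'n) monoid_scheme"
    and H :: "'g set"
    and enc :: "(('g \<Rightarrow> 'k) \<Rightarrow> 'u) \<Rightarrow> 'u"
    and CG CH :: "(('g \<Rightarrow> 'k, 'u) module, ('g \<Rightarrow> 'k, 'u) mod_arr) cat"
  assumes "cring k" and "group G" and "subgroup H G"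
    and "inj enc"
  defines "CG \<equiv> module_cat (group_algebra k G)"
    and "CH \<equiv> module_cat (subgroup_algebra k G H)"
  defines "A \<equiv> coind_monad k G H enc"
    and "E \<equiv> eilenberg_moore_functor CH (CoInd k G H enc) (res_coind_counit k G H enc)"
  shows "is_adjunction CG CH (Res k G H) (CoInd k G H enc)
           (res_coind_unit k G H enc) (res_coind_counit k G H enc) \<and>
         is_monad CG A \<and>
         functor_eq CG (E \<circ>\<^sub>F Res k G H) (extension_functor CG A) \<and>
         functor_eq CH (forgetful_functor \<circ>\<^sub>F E) (CoInd k G H enc) \<and>
         is_equivalence CH (monad_module_cat CG A) E"
proof -
  interpret group_ring_subgroup k G H
    using assms(1-3) by (intro group_ring_subgroup.intro group_ring.intro) (auto intro: cring.axioms)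
  interpret ring_extension KG KH enc by (rule ring_extension_KH) fact
  have adj: "is_adjunction CG CH (Res k G H) (CoInd k G H enc)
      (res_coind_unit k G H enc) (res_coind_counit k G H enc)"
    unfolding CG_def CH_def Res_eq CoInd_eq res_coind_unit_eq res_coind_counit_eq
    by (rule restriction_coinduction_adjunction)
  interpret adj: adjunction CG CH "Res k G H" "CoInd k G H enc"
    "res_coind_unit k G H enc" "res_coind_counit k G H enc"
    by (rule adjunctionI) (rule adj)
  have "is_equivalence CH (monad_module_cat CG A) E"
    unfolding CG_def CH_def A_def E_def coind_monad_def Res_eq CoInd_eq res_coind_unit_eq
      res_coind_counit_eq
  proof (rule coinduction_monadic_if_bimodule_retract[where \<pi> = cutoff])
    show "cutoff \<one>\<^bsub>KG\<^esub> = \<one>\<^bsub>KH\<^esub>"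
      by (auto simp: fun_eq_iff cutoff_def one_apply H.one_apply)
  qed (auto simp: cutoff_closed cutoff_mult_left cutoff_mult_right fun_eq_iff cutoff_def)
  then show ?thesis
    using adj adj.is_monad_of_adjunction adj.eilenberg_moore_comp_left
      adj.forgetful_comp_eilenberg_moore
    by (simp add: A_def E_def coind_monad_def)
qed

end
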